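(* (a) Let $G$ be a finite abelian group. Then $G$ can be integrated $n$ times for every natural number $n$, even within the class of finite nilpotent groups (that is, for every natural number $n$ there is a finite nilpotent group $H$ with $H^{(n)}\cong G$). (b) A finite group can be integrated $n$ times for every natural number $n$ if and only if it is a central product of a perfect group and an abelian group.
   Context: For a group $H$, $H^{(n)}$ denotes the $n$th derived group: $H^{(0)}=H$ and $H^{(n+1)}=(H^{(n)})'$, where $'$ denotes the derived group (commutator subgroup). A group $G$ can be integrated $n$ times if there exists a group $H$ with $H^{(n)}\cong G$. A group $N$ is perfect if $N'=N$ (the trivial group is perfect). A group $G$ is a central product of $N$ and $A$ if $N$ and $A$ are normal subgroups of $G$ with $G=NA$ and $[N,A]=1$. *)

theory Defs
  imports "HOL-Algebra.Algebra"
begin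

text \<open>
  The library's \<open>derived H K\<close> is the derived subgroup of a subgroup \<open>K\<close>, generated inside the
  ambient group \<open>H\<close>; iterating it from \<open>carrier H\<close> gives the derived series, as in the library's
  treatment of solvable groups.
\<close>
definition nth_derived_group :: "nat \<Rightarrow> ('h, 'c) monoid_scheme \<Rightarrow> ('h, 'c) monoid_scheme" where
  "nth_derived_group n H = H\<lparr>carrier := (derived H ^^ n) (carrier H)\<rparr>"

text \<open>
  HOL cannot quantify existentially over types, so the type \<open>'h\<close> of the elements of \<open>H\<close> is a
  parameter. For finite \<open>G\<close> every infinite \<open>'h\<close> gives the same notion: if \<open>H\<^sup>(\<^sup>n\<^sup>)\<close> is finite, finitely many
  elements of \<open>H\<close> already generate a (countable) subgroup with the same \<open>n\<close>th derived group.
\<close>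
definition integrable_times :: "'h itself \<Rightarrow> nat \<Rightarrow> ('a, 'b) monoid_scheme \<Rightarrow> bool" where
  "integrable_times _ n G \<longleftrightarrow> (\<exists>H :: 'h monoid. group H \<and> nth_derived_group n H \<cong> G)"

definition commutator_subgroup :: "('a, 'b) monoid_scheme \<Rightarrow> 'a set \<Rightarrow> 'a set \<Rightarrow> 'a set" where
  "commutator_subgroup G K L =
     generate G (\<Union>x \<in> K. \<Union>y \<in> L. {x \<otimes>\<^bsub>G\<^esub> y \<otimes>\<^bsub>G\<^esub> inv\<^bsub>G\<^esub> x \<otimes>\<^bsub>G\<^esub> inv\<^bsub>G\<^esub> y})"

primrec lower_central_series :: "('a, 'b) monoid_scheme \<Rightarrow> nat \<Rightarrow> 'a set" where
  "lower_central_series G 0 = carrier G"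
| "lower_central_series G (Suc i) = commutator_subgroup G (lower_central_series G i) (carrier G)"

definition nilpotent_group :: "('a, 'b) monoid_scheme \<Rightarrow> bool" where
  "nilpotent_group G \<longleftrightarrow> group G \<and> (\<exists>c. lower_central_series G c = {\<one>\<^bsub>G\<^esub>})"

definition perfect_group :: "('a, 'b) monoid_scheme \<Rightarrow> bool" where
  "perfect_group G \<longleftrightarrow> group G \<and> derived G (carrier G) = carrier G"

definition central_product :: "('a, 'b) monoid_scheme \<Rightarrow> 'a set \<Rightarrow> 'a set \<Rightarrow> bool" where
  "central_product G N A \<longleftrightarrow>
     N \<lhd> G \<and> A \<lhd> G \<and> carrier G = N <#>\<^bsub>G\<^esub> A \<and> commutator_subgroup G N A = {\<one>\<^bsub>G\<^esub>}"

end

theory Submission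
  imports Defs
begin

text \<open>
  If \<open>G = H\<^sup>(\<^sup>n\<^sup>)\<close> with \<open>n\<close> large, then the derived series of the image of \<open>H\<close> in the permutations of
  \<open>G\<close> (under conjugation) is stationary from its \<open>n\<close>th term on. So every element of \<open>G\<close> acts on \<open>G\<close>
  like an element of \<open>G'\<close>, that is, \<open>G = G' Z(G)\<close>, whence \<open>G'' = G'\<close> and \<open>G\<close> is the central product
  of \<open>G'\<close> and \<open>Z(G)\<close>.

  Conversely, let \<open>G\<close> be the central product of a perfect group \<open>N\<close> and an abelian group \<open>A\<close>. The
  group \<open>T\<close> of automorphisms of \<open>A\<^sup>m\<close>, with \<open>m = (2\<^sup>n + 1) |A|\<close>, that are unitriangular with respect to
  the \<open>2\<^sup>n + 1\<close> blocks is nilpotent, \<open>T\<^sup>(\<^sup>n\<^sup>)\<close> is central in \<open>T\<close>, and there is a surjective homomorphism \<open>\<iota>\<close> from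
  \<open>T\<^sup>(\<^sup>n\<^sup>)\<close> to \<open>A\<close>. Identifying each \<open>c\<close> in \<open>T\<^sup>(\<^sup>n\<^sup>)\<close> with \<open>\<iota> c\<close> in the product of \<open>G\<close> and \<open>T\<close> gives a group
  whose \<open>n\<close>th derived group is \<open>N A = G\<close>.
\<close>

section \<open>Descending chains, centres and the conjugation action\<close>

lemma funpow_decreasing_stable:
  fixes F :: "'a set \<Rightarrow> 'a set"
  assumes decr: "\<And>m. (F ^^ Suc m) S \<subseteq> (F ^^ m) S" and fin: "finite S" and "card S \<le> n"
  shows "(F ^^ Suc n) S = (F ^^ n) S"
proof -
  have sub: "(F ^^ m) S \<subseteq> S" for m
  proof (induction m)
    case (Suc m)
    then show ?case using decr[of m] by blast
  qed simp
  have finm: "finite ((F ^^ m) S)" for m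
    using finite_subset[OF sub fin] .
  \<comment> \<open>As long as the chain has not stopped, each step loses at least one element; once
    two consecutive terms agree, all later ones agree too.\<close>
  have *: "(F ^^ Suc m) S = (F ^^ m) S \<or> card ((F ^^ m) S) + m \<le> card S" for m
  proof (induction m)
    case (Suc m)
    show ?case
    proof (cases "(F ^^ Suc m) S = (F ^^ m) S")
      case False
      then have "card ((F ^^ Suc m) S) < card ((F ^^ m) S)"
        using decr[of m] finm[of m] by (meson psubsetI psubset_card_mono)
      with Suc False show ?thesis by simp
    qed (metis comp_apply funpow.simps(2))
  qed simp
  show ?thesis
  proof (cases "(F ^^ Suc n) S = (F ^^ n) S")
    case False
    \<comment> \<open>A chain still moving after \<open>n\<close> steps, with \<open>n\<close> at
      least \<open>card S\<close>, has used up all of \<open>S\<close>, and the empty set admits no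
      further descent.\<close>
    with *[of n] assms(3) have "card ((F ^^ n) S) = 0" by simp
    with finm have "(F ^^ n) S = {}" by simp
    with decr[of n] show ?thesis by simp
  qed
qed

lemma (in group) inv_cancel_left:
  assumes "x \<in> carrier G" "y \<in> carrier G"
  shows "x \<otimes> (inv x \<otimes> y) = y" "inv x \<otimes> (x \<otimes> y) = y"
  using assms by (simp_all add: m_assoc[symmetric])

definition centre :: "('a, 'b) monoid_scheme \<Rightarrow> 'a set" where
  "centre G = {z \<in> carrier G. \<forall>x \<in> carrier G. z \<otimes>\<^bsub>G\<^esub> x = x \<otimes>\<^bsub>G\<^esub> z}"

lemma (in group) subgroup_centre: "subgroup (centre G) G"
proof (rule subgroupI)
  fix a assume "a \<in> centre G"
  then show "inv a \<in> centre G"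
    unfolding centre_def by (auto simp: inv_solve_left inv_solve_right m_assoc)
next
  fix a b assume ab: "a \<in> centre G" "b \<in> centre G"
  have "a \<otimes> b \<otimes> x = x \<otimes> (a \<otimes> b)" if "x \<in> carrier G" for x
  proof -
    have "a \<in> carrier G" "b \<in> carrier G" "a \<otimes> x = x \<otimes> a" "b \<otimes> x = x \<otimes> b"
      using ab that by (auto simp: centre_def)
    with that show ?thesis by (metis m_assoc)
  qed
  then show "a \<otimes> b \<in> centre G"
    using ab m_closed unfolding centre_def by blast
qed (auto simp: centre_def)

lemma (in group) subset_centre_normal:
  assumes "subgroup K G" "K \<subseteq> centre G"
  shows "K \<lhd> G"
  unfolding normal_inv_iff
proof (intro conjI ballI)
  fix x h assume "x \<in> carrier G" "h \<in> K"
  then have "h \<in> carrier G" "h \<otimes> x = x \<otimes> h" using assms(2) by (auto simp: centre_def)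
  then have "x \<otimes> h \<otimes> inv x = h" using \<open>x \<in> carrier G\<close> by (metis inv_solve_right m_closed)
  with \<open>h \<in> K\<close> show "x \<otimes> h \<otimes> inv x \<in> K" by simp
qed (fact assms(1))

text \<open>The conjugations are restricted to \<open>D\<close> because the elements of
  \<open>BijGroup D\<close> are extensional functions. Normality of \<open>D\<close> makes them
  permutations, with conjugation by \<open>inv g\<close> as inverse.\<close>

lemma (in group) conjugation_hom:
  assumes "D \<lhd> G"
  shows "(\<lambda>g. \<lambda>d\<in>D. g \<otimes> d \<otimes> inv g) \<in> hom G (BijGroup D)"
proof -
  interpret D: normal D G by fact
  have closed: "g \<otimes> d \<otimes> inv g \<in> D" if "g \<in> carrier G" "d \<in> D" for g d
    using D.inv_op_closed2 that by blast
  have bij: "(\<lambda>d\<in>D. g \<otimes> d \<otimes> inv g) \<in> Bij D" if g: "g \<in> carrier G" for g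
  proof -
    have "bij_betw (\<lambda>d. g \<otimes> d \<otimes> inv g) D D"
    proof (rule bij_betw_byWitness[where f' = "\<lambda>d. inv g \<otimes> d \<otimes> g"])
      show "(\<lambda>d. inv g \<otimes> d \<otimes> g) ` D \<subseteq> D"
        using D.inv_op_closed1 g by blast
    qed (use g closed in \<open>auto simp: m_assoc inv_cancel_left\<close>)
    then show ?thesis
      unfolding Bij_def by (auto simp: bij_betw_restrict_eq cong: bij_betw_cong)
  qed
  show ?thesis
  proof (rule homI)
    fix x y assume xy: "x \<in> carrier G" "y \<in> carrier G"
    show "(\<lambda>d\<in>D. x \<otimes> y \<otimes> d \<otimes> inv (x \<otimes> y)) =
          (\<lambda>d\<in>D. x \<otimes> d \<otimes> inv x) \<otimes>\<^bsub>BijGroup D\<^esub> (\<lambda>d\<in>D. y \<otimes> d \<otimes> inv y)"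
      using xy bij closed
      by (auto simp: BijGroup_def compose_def fun_eq_iff m_assoc inv_mult_group)
  qed (use bij in \<open>simp add: BijGroup_def\<close>)
qed

lemma (in group) exp_of_derived_decreasing:
  assumes "subgroup K G"
  shows "(derived G ^^ Suc m) K \<subseteq> (derived G ^^ m) K"
  using derived_incl[OF order_refl exp_of_derived_is_subgroup[OF assms]] by simp

lemma (in group) exp_of_derived_normal: "(derived G ^^ n) (carrier G) \<lhd> G"
  by (induction n) (auto intro: derived_is_normal normal_self)

lemma (in group) nth_derived_group_group: "group (nth_derived_group n G)"
  unfolding nth_derived_group_def
  by (intro subgroup_imp_group exp_of_derived_is_subgroup subgroup_self)

text \<open>A permutation is one of the \<open>card S ^ card S\<close> extensional self-maps of
  \<open>S\<close>. This crude bound is enough, since it depends on \<open>card S\<close> only; it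
  fixes the number of integrations used for necessity.\<close>

lemma finite_BijGroup: "finite S \<Longrightarrow> finite (carrier (BijGroup S))"
  and card_BijGroup: "finite S \<Longrightarrow> card (carrier (BijGroup S)) \<le> card S ^ card S"
proof -
  assume S: "finite S"
  have sub: "carrier (BijGroup S) \<subseteq> S \<rightarrow>\<^sub>E S"
    by (auto simp: BijGroup_def Bij_def bij_betw_def PiE_def)
  show "finite (carrier (BijGroup S))"
    using finite_subset[OF sub] S by (simp add: finite_PiE)
  show "card (carrier (BijGroup S)) \<le> card S ^ card S"
    using card_mono[OF _ sub] S by (simp add: finite_PiE card_PiE)
qed

text \<open>Conjugation maps \<open>G\<close> to the finite group of permutations of \<open>D\<close>, where the derived series
  becomes stationary, so that every element of \<open>D\<close> acts on \<open>D\<close> like an element of \<open>D'\<close>.\<close>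

lemma (in group) late_derived_group_eq_derived_mult_centre:
  fixes n :: nat
  defines "D \<equiv> (derived G ^^ n) (carrier G)"
  assumes fin: "finite D" and n: "card D ^ card D \<le> n" and d: "d \<in> D"
  shows "\<exists>y \<in> derived G D. \<exists>z \<in> centre (G\<lparr>carrier := D\<rparr>). d = y \<otimes> z"
proof -
  define \<phi> where "\<phi> = (\<lambda>g. \<lambda>d\<in>D. g \<otimes> d \<otimes> inv g)"
  have nD: "D \<lhd> G" unfolding D_def by (rule exp_of_derived_normal)
  interpret D: normal D G by fact
  interpret \<phi>: group_hom G "BijGroup D" \<phi>
    unfolding \<phi>_def group_hom_def group_hom_axioms_def
    by (simp add: is_group group_BijGroup conjugation_hom[OF nD])
  let ?K = "\<phi> ` carrier G"
  have K: "subgroup ?K (BijGroup D)" by (rule \<phi>.img_is_subgroup)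
  have finK: "finite ?K" and "card ?K \<le> n"
    using finite_BijGroup[OF fin] card_BijGroup[OF fin] n subgroup.subset[OF K]
    by (auto intro: finite_subset) (meson card_mono le_trans)
  then have "(derived (BijGroup D) ^^ Suc n) ?K = (derived (BijGroup D) ^^ n) ?K"
    using \<phi>.H.exp_of_derived_decreasing[OF K] by (intro funpow_decreasing_stable)
  \<comment> \<open>Derived series commute with homomorphic images, so terms \<open>n\<close> and
    \<open>Suc n\<close> of the series of \<open>?K\<close> are the images of \<open>D\<close> and
    of \<open>derived G D\<close>.\<close>
  then have "\<phi> ` derived G D = \<phi> ` D"
    by (simp only: \<phi>.exp_of_derived_img[OF order_refl] D_def[symmetric] funpow.simps comp_apply
        \<phi>.derived_img[OF D.subset])
  with d obtain y where y: "y \<in> derived G D" and eq: "\<phi> d = \<phi> y"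
    by (metis (no_types, lifting) imageE imageI)
  have yD: "y \<in> D" using y derived_incl[OF order_refl D.subgroup_axioms] by blast
  have yG: "y \<in> carrier G" and dG: "d \<in> carrier G" using yD d D.subset by blast+
  \<comment> \<open>Since \<open>d\<close> and \<open>y\<close> induce the same permutation of
    \<open>D\<close>, their quotient centralizes \<open>D\<close>.\<close>
  have "inv y \<otimes> d \<in> centre (G\<lparr>carrier := D\<rparr>)"
    unfolding centre_def
  proof (clarsimp, intro conjI ballI)
    show "inv y \<otimes> d \<in> D" using yD d by blast
    fix x assume x: "x \<in> D"
    then have xG: "x \<in> carrier G" using D.subset by blast
    have "d \<otimes> x \<otimes> inv d = y \<otimes> x \<otimes> inv y"
      using fun_cong[OF eq, of x] x by (simp add: \<phi>_def)
    then have "d \<otimes> x = y \<otimes> x \<otimes> inv y \<otimes> d"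
      using inv_solve_right' [of "y \<otimes> x \<otimes> inv y" "d \<otimes> x" d] xG yG dG by simp
    then show "inv y \<otimes> d \<otimes> x = x \<otimes> (inv y \<otimes> d)"
      using xG yG dG by (simp add: m_assoc inv_solve_left')
  qed
  moreover have "d = y \<otimes> (inv y \<otimes> d)" using yG dG by (simp add: m_assoc[symmetric])
  ultimately show ?thesis using y by blast
qed

section \<open>Necessity of the central product decomposition\<close>

lemma (in group) commutator_mult_central:
  assumes z: "z \<in> carrier G" "\<And>u. u \<in> carrier G \<Longrightarrow> z \<otimes> u = u \<otimes> z"
    and xy: "x \<in> carrier G" "y \<in> carrier G"
  shows "(x \<otimes> z) \<otimes> y \<otimes> inv (x \<otimes> z) \<otimes> inv y = x \<otimes> y \<otimes> inv x \<otimes> inv y"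
    and "y \<otimes> (x \<otimes> z) \<otimes> inv y \<otimes> inv (x \<otimes> z) = y \<otimes> x \<otimes> inv y \<otimes> inv x"
proof -
  have "(x \<otimes> z) \<otimes> y \<otimes> inv (x \<otimes> z) = x \<otimes> (z \<otimes> y) \<otimes> inv z \<otimes> inv x"
    using z(1) xy by (simp add: m_assoc inv_mult_group)
  also have "\<dots> = x \<otimes> y \<otimes> inv x"
    unfolding z(2)[OF xy(2)] using z(1) xy by (simp add: m_assoc inv_cancel_left)
  finally show "(x \<otimes> z) \<otimes> y \<otimes> inv (x \<otimes> z) \<otimes> inv y = x \<otimes> y \<otimes> inv x \<otimes> inv y" by simp
  have "y \<otimes> (x \<otimes> z) \<otimes> inv y \<otimes> inv (x \<otimes> z) = y \<otimes> x \<otimes> (z \<otimes> inv y) \<otimes> inv z \<otimes> inv x"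
    using z(1) xy by (simp add: m_assoc inv_mult_group)
  also have "\<dots> = y \<otimes> x \<otimes> inv y \<otimes> inv x"
    unfolding z(2)[OF inv_closed[OF xy(2)]] using z(1) xy by (simp add: m_assoc inv_cancel_left)
  finally show "y \<otimes> (x \<otimes> z) \<otimes> inv y \<otimes> inv (x \<otimes> z) = y \<otimes> x \<otimes> inv y \<otimes> inv x" .
qed

lemma (in group) derived_centre_central_product:
  assumes dec: "\<And>x. x \<in> carrier G \<Longrightarrow> \<exists>y \<in> derived G (carrier G). \<exists>z \<in> centre G. x = y \<otimes> z"
  defines "N \<equiv> derived G (carrier G)"
  shows "central_product G N (centre G)" "perfect_group (G\<lparr>carrier := N\<rparr>)"
    "comm_group (G\<lparr>carrier := centre G\<rparr>)"
proof -
  have nN: "N \<lhd> G" unfolding N_def by (rule derived_self_is_normal)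
  interpret N: normal N G by fact
  have Z: "centre G \<subseteq> carrier G" by (auto simp: centre_def)
  have central: "z \<otimes> x = x \<otimes> z" if "z \<in> centre G" "x \<in> carrier G" for x z
    using that by (simp add: centre_def)
  have sub: "commutator_subgroup G N (centre G) = {\<one>}"
  proof -
    have "x \<otimes> y \<otimes> inv x \<otimes> inv y = \<one>" if "x \<in> N" "y \<in> centre G" for x y
    proof -
      have xy: "x \<in> carrier G" "y \<in> carrier G" using that Z N.subset by auto
      then have "x \<otimes> y = y \<otimes> x" using central that by simp
      then show ?thesis using xy by (simp add: m_assoc)
    qed
    moreover have "\<one> \<in> N" "\<one> \<in> centre G" by (auto simp: centre_def)
    ultimately have "(\<Union>x \<in> N. \<Union>y \<in> centre G. {x \<otimes> y \<otimes> inv x \<otimes> inv y}) = {\<one>}"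
      by (intro equalityI subsetI) (elim UN_E, simp, intro UN_I[of \<one>], simp_all)
    then show ?thesis unfolding commutator_subgroup_def using generate_one by simp
  qed
  have "carrier G = N <#> centre G"
    using dec N.subset Z unfolding set_mult_def N_def by (auto simp: subset_iff)
  then show "central_product G N (centre G)"
    unfolding central_product_def
    using sub nN subset_centre_normal[OF subgroup_centre] by blast
  \<comment> \<open>Central factors cancel from a commutator, so by \<open>dec\<close> every
    commutator in \<open>G\<close> is a commutator of two elements of \<open>N\<close>. This gives
    perfectness of \<open>N\<close>.\<close>
  have "derived_set G (carrier G) \<subseteq> derived G N"
  proof
    fix c assume "c \<in> derived_set G (carrier G)"
    then obtain x x' where x: "x \<in> carrier G" "x' \<in> carrier G" "c = x \<otimes> x' \<otimes> inv x \<otimes> inv x'"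
      by blast
    obtain y z where yz: "y \<in> N" "z \<in> centre G" "x = y \<otimes> z" using dec[OF x(1)] N_def by blast
    obtain y' z' where yz': "y' \<in> N" "z' \<in> centre G" "x' = y' \<otimes> z'" using dec[OF x(2)] N_def by blast
    have car: "y \<in> carrier G" "z \<in> carrier G" "y' \<in> carrier G" "z' \<in> carrier G"
      using yz yz' N.subset Z by auto
    have "c = y \<otimes> y' \<otimes> inv y \<otimes> inv y'"
      using commutator_mult_central[of z y x'] commutator_mult_central[of z' y' y] x yz yz' car central
      by simp
    then show "c \<in> derived G N"
      unfolding derived_def using yz yz' by (blast intro: generate.incl)
  qed
  then have "N \<subseteq> derived G N"
    unfolding N_def derived_def[of G "carrier G"]
    by (rule generate_subgroup_incl) (use derived_is_subgroup[OF N.subset] in \<open>simp add: N_def derived_def\<close>)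
  then have "derived G N = N" using derived_incl[OF order_refl N.subgroup_axioms] by blast
  then show "perfect_group (G\<lparr>carrier := N\<rparr>)"
    unfolding perfect_group_def
    using derived_consistent[OF order_refl N.subgroup_axioms] subgroup_imp_group[OF N.subgroup_axioms]
    by simp
  show "comm_group (G\<lparr>carrier := centre G\<rparr>)"
    using Z central
    by (intro group.group_comm_groupI subgroup_imp_group subgroup_centre) auto
qed

lemma (in group) integrable_imp_central_product:
  assumes fin: "finite (carrier G)" and int: "\<And>n. integrable_times TYPE('h) n G"
  shows "\<exists>N A. central_product G N A \<and> perfect_group (G\<lparr>carrier := N\<rparr>) \<and>
    comm_group (G\<lparr>carrier := A\<rparr>)"
proof -
  \<comment> \<open>This \<open>n\<close> depends on \<open>G\<close> alone. As
    \<open>\<theta>\<close> gives \<open>card D = card (carrier G)\<close>, it meets the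
    stationarity bound for the permutations of \<open>D\<close>, whatever the size of
    \<open>H\<close>.\<close>
  define n where "n = card (carrier G) ^ card (carrier G)"
  from int[of n] obtain H :: "'h monoid" and \<theta>
    where H: "group H" and \<theta>: "\<theta> \<in> iso (nth_derived_group n H) G"
    unfolding integrable_times_def is_iso_def by blast
  interpret H: group H by fact
  define D where "D = (derived H ^^ n) (carrier H)"
  have P: "nth_derived_group n H = H\<lparr>carrier := D\<rparr>" by (simp add: nth_derived_group_def D_def)
  have sD: "subgroup D H" unfolding D_def by (intro H.exp_of_derived_is_subgroup H.subgroup_self)
  interpret \<theta>: group_hom "H\<lparr>carrier := D\<rparr>" G \<theta>
    using \<theta> H.subgroup_imp_group[OF sD] is_group
    unfolding P group_hom_def group_hom_axioms_def iso_def by simp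
  have bij: "bij_betw \<theta> D (carrier G)" using \<theta> unfolding P iso_def by simp
  have surj: "\<theta> ` D = carrier G" using bij by (simp add: bij_betw_def)
  have "finite D" "card D = card (carrier G)"
    using bij fin bij_betw_finite bij_betw_same_card by blast+
  then have dec: "\<exists>y \<in> derived H D. \<exists>z \<in> centre (H\<lparr>carrier := D\<rparr>). d = y \<otimes>\<^bsub>H\<^esub> z" if "d \<in> D" for d
    using H.late_derived_group_eq_derived_mult_centre[of n d] that by (simp add: D_def n_def)
  have der: "derived G (carrier G) = \<theta> ` derived H D"
    using \<theta>.derived_img[of D] surj H.derived_consistent[OF order_refl sD] by simp
  have "\<exists>y \<in> derived G (carrier G). \<exists>z \<in> centre G. x = y \<otimes> z" if x: "x \<in> carrier G" for x
  proof -
    obtain d where d: "d \<in> D" "x = \<theta> d"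
      using x unfolding surj[symmetric] by (rule imageE)
    obtain y z where yz: "y \<in> derived H D" "z \<in> centre (H\<lparr>carrier := D\<rparr>)" "d = y \<otimes>\<^bsub>H\<^esub> z"
      using dec[OF d(1)] by (elim bexE)
    have yD: "y \<in> D" using yz(1) H.derived_incl[OF order_refl sD] by blast
    have zD: "z \<in> D" and zc: "\<And>w. w \<in> D \<Longrightarrow> z \<otimes>\<^bsub>H\<^esub> w = w \<otimes>\<^bsub>H\<^esub> z" using yz(2) by (auto simp: centre_def)
    have "\<theta> z \<otimes> w = w \<otimes> \<theta> z" if w: "w \<in> carrier G" for w
    proof -
      obtain v where v: "v \<in> D" "w = \<theta> v" using w unfolding surj[symmetric] by (rule imageE)
      have "\<theta> (z \<otimes>\<^bsub>H\<^esub> v) = \<theta> z \<otimes> \<theta> v" "\<theta> (v \<otimes>\<^bsub>H\<^esub> z) = \<theta> v \<otimes> \<theta> z"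
        using \<theta>.hom_mult v(1) zD by simp_all
      then show ?thesis unfolding v(2) using zc[OF v(1)] by metis
    qed
    then have "\<theta> z \<in> centre G" using zD surj by (auto simp: centre_def)
    moreover have "x = \<theta> y \<otimes> \<theta> z" using \<theta>.hom_mult[of y z] yD zD d yz by simp
    ultimately show ?thesis using der yz(1) by blast
  qed
  from derived_centre_central_product[OF this] show ?thesis by blast
qed

section \<open>Filtrations and unitriangular automorphisms\<close>

lemma (in group)
  fixes U :: "nat \<Rightarrow> 'a set"
  assumes U: "\<And>k. 1 \<le> k \<Longrightarrow> subgroup (U k) G" and U1: "carrier G \<subseteq> U 1"
    and comm: "\<And>k l x y. \<lbrakk>1 \<le> k; 1 \<le> l; x \<in> U k; y \<in> U l\<rbrakk> \<Longrightarrow> x \<otimes> y \<otimes> inv x \<otimes> inv y \<in> U (k + l)"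
  shows exp_of_derived_subset_filtration: "(derived G ^^ m) (carrier G) \<subseteq> U (2 ^ m)"
    and lower_central_series_subset_filtration: "lower_central_series G i \<subseteq> U (Suc i)"
proof -
  \<comment> \<open>Commutators add indices. Starting from \<open>U 1\<close>, a derived step
    doubles the index, whereas a step of the lower central series, a commutator with
    \<open>U 1\<close>, raises it by one.\<close>
  show "(derived G ^^ m) (carrier G) \<subseteq> U (2 ^ m)"
  proof (induction m)
    case (Suc m)
    have "derived_set G ((derived G ^^ m) (carrier G)) \<subseteq> U (2 ^ m + 2 ^ m)"
      using comm[of "2 ^ m" "2 ^ m"] Suc by auto
    then have "derived G ((derived G ^^ m) (carrier G)) \<subseteq> U (2 ^ m + 2 ^ m)"
      unfolding derived_def by (intro generate_subgroup_incl U) (simp_all add: Suc_leI)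
    then show ?case by (simp add: mult_2)
  qed (use U1 in simp)
  show "lower_central_series G i \<subseteq> U (Suc i)"
  proof (induction i)
    case (Suc i)
    have "(\<Union>x \<in> lower_central_series G i. \<Union>y \<in> carrier G. {x \<otimes> y \<otimes> inv x \<otimes> inv y}) \<subseteq> U (Suc i + 1)"
      using comm[of "Suc i" 1] Suc U1 by auto
    then show ?case
      unfolding lower_central_series.simps commutator_subgroup_def
      using generate_subgroup_incl[OF _ U[of "Suc i + 1"]] by simp
  qed (use U1 in simp)
qed

context comm_group
begin

lemma mult_inv_mult_cancel:
  assumes "m \<in> carrier G" "p \<in> carrier G" "q \<in> carrier G"
  shows "(m \<otimes> p) \<otimes> inv (m \<otimes> q) = p \<otimes> inv q"
  using assms by (simp add: m_comm[of m p] inv_mult m_assoc inv_cancel_left)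

lemma AutoGroup_mult_apply:
  assumes "f \<in> auto G" "g \<in> auto G" "v \<in> carrier G"
  shows "(f \<otimes>\<^bsub>AutoGroup G\<^esub> g) v = f (g v)"
  using assms by (simp add: AutoGroup_def BijGroup_def auto_def compose_def)

lemma auto_closed: "f \<in> auto G \<Longrightarrow> v \<in> carrier G \<Longrightarrow> f v \<in> carrier G"
  by (auto simp: auto_def hom_def)

lemma auto_mult:
  "f \<in> auto G \<Longrightarrow> v \<in> carrier G \<Longrightarrow> w \<in> carrier G \<Longrightarrow> f (v \<otimes> w) = f v \<otimes> f w"
  by (simp add: auto_def hom_def)

lemma auto_eqI:
  assumes "f \<in> auto G" "g \<in> auto G" "\<And>v. v \<in> carrier G \<Longrightarrow> f v = g v"
  shows "f = g"
  using assms by (intro extensionalityI[of f "carrier G" g]) (auto simp: auto_def Bij_def)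

lemma carrier_AutoGroup: "carrier (AutoGroup G) = auto G"
  and one_AutoGroup: "\<one>\<^bsub>AutoGroup G\<^esub> = (\<lambda>v \<in> carrier G. v)"
  by (simp_all add: AutoGroup_def BijGroup_def)

lemma AutoGroup_inv_apply:
  assumes "f \<in> auto G" "v \<in> carrier G"
  shows "f ((inv\<^bsub>AutoGroup G\<^esub> f) v) = v" "(inv\<^bsub>AutoGroup G\<^esub> f) (f v) = v"
proof -
  interpret Aut: group "AutoGroup G" by (rule AutoGroup)
  have f: "f \<in> carrier (AutoGroup G)" "inv\<^bsub>AutoGroup G\<^esub> f \<in> auto G"
    using assms(1) Aut.inv_closed carrier_AutoGroup by simp_all
  show "f ((inv\<^bsub>AutoGroup G\<^esub> f) v) = v" "(inv\<^bsub>AutoGroup G\<^esub> f) (f v) = v"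
    using Aut.r_inv[OF f(1)] Aut.l_inv[OF f(1)] f(2) assms
      AutoGroup_mult_apply[of f "inv\<^bsub>AutoGroup G\<^esub> f" v]
      AutoGroup_mult_apply[of "inv\<^bsub>AutoGroup G\<^esub> f" f v]
    by (simp_all add: one_AutoGroup)
qed

end

text \<open>The descending chain \<open>V\<close> plays the part of a flag, so that the commutator
  calculus of unitriangular matrices can be carried out without coordinates. Finiteness turns
  injective self-maps of the terms \<open>V s\<close> into bijections.\<close>

locale filtered_comm_group = comm_group W for W (structure) +
  fixes V :: "nat \<Rightarrow> 'a set" and N :: nat
  assumes finite_carrier: "finite (carrier W)"
    and V_subgroup: "subgroup (V s) W"
    and V_0: "V 0 = carrier W"
    and V_antimono: "s \<le> t \<Longrightarrow> V t \<subseteq> V s"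
    and V_N: "V N = {\<one>}"
begin

abbreviation "Aut \<equiv> AutoGroup W"

text \<open>For the standard filtration of a free module, \<open>U 1\<close> is the group of unitriangular matrices
  and \<open>U k\<close> consists of those whose first \<open>k - 1\<close> secondary diagonals vanish.\<close>

definition U :: "nat \<Rightarrow> ('a \<Rightarrow> 'a) set" where
  "U k = {f \<in> auto W. \<forall>s. \<forall>v \<in> V s. f v \<otimes> inv v \<in> V (s + k)}"

lemma V_carrier: "v \<in> V s \<Longrightarrow> v \<in> carrier W"
  using subgroup.subset[OF V_subgroup] by blast

lemma U_auto: "f \<in> U k \<Longrightarrow> f \<in> auto W"
  by (simp add: U_def)

lemma U_shift: "f \<in> U k \<Longrightarrow> v \<in> V s \<Longrightarrow> f v \<otimes> inv v \<in> V (s + k)"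
  by (simp add: U_def)

lemma U_preserves:
  assumes "f \<in> U k" "v \<in> V s"
  shows "f v \<in> V s"
proof -
  have "f v \<otimes> inv v \<in> V s" using U_shift[OF assms] V_antimono[of s "s + k"] by auto
  then have "f v \<otimes> inv v \<otimes> v \<in> V s"
    using assms(2) by (rule subgroup.m_closed[OF V_subgroup])
  then show ?thesis
    using V_carrier[OF assms(2)] auto_closed[OF U_auto[OF assms(1)]] by (simp add: m_assoc)
qed

text \<open>An injective self-map of the finite set \<open>V s\<close> is onto, so the preimage of
  \<open>v\<close> under \<open>f\<close> already lies in \<open>V s\<close>.\<close>

lemma U_inv_preserves:
  assumes "f \<in> U k" "v \<in> V s"
  shows "(inv\<^bsub>Aut\<^esub> f) v \<in> V s"
proof -
  have "inj_on f (V s)"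
    using U_auto[OF assms(1)] V_carrier
    by (auto simp: auto_def Bij_def bij_betw_def intro: inj_on_subset)
  moreover have "f ` V s \<subseteq> V s" using U_preserves[OF assms(1)] by blast
  moreover have "finite (V s)" using finite_subset[OF _ finite_carrier] V_carrier by blast
  ultimately have "f ` V s = V s" by (simp add: endo_inj_surj)
  then obtain w where "w \<in> V s" "v = f w" using assms(2) by (metis imageE)
  then show ?thesis using AutoGroup_inv_apply(2)[OF U_auto[OF assms(1)] V_carrier] by simp
qed

lemma U_subgroup: "subgroup (U k) Aut"
proof -
  interpret Aut: group Aut by (rule AutoGroup)
  show ?thesis
  proof (rule Aut.subgroupI)
    show "U k \<subseteq> carrier Aut" using U_auto by (auto simp: carrier_AutoGroup)
    have "(\<lambda>v \<in> carrier W. v) \<in> U k"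
      using id_in_auto V_carrier subgroup.one_closed[OF V_subgroup] by (auto simp: U_def)
    then show "U k \<noteq> {}" by blast
  next
    fix f assume f: "f \<in> U k"
    have f': "inv\<^bsub>Aut\<^esub> f \<in> auto W" using U_auto[OF f] Aut.inv_closed by (simp add: carrier_AutoGroup)
    have "(inv\<^bsub>Aut\<^esub> f) v \<otimes> inv v \<in> V (s + k)" if v: "v \<in> V s" for s v
    proof -
      \<comment> \<open>The shift of the inverse at \<open>v\<close> is the inverse of the shift of
        \<open>f\<close> at the preimage \<open>w\<close> of \<open>v\<close>.\<close>
      define w where "w = (inv\<^bsub>Aut\<^esub> f) v"
      have w: "w \<in> V s" unfolding w_def by (rule U_inv_preserves[OF f v])
      have "f w = v" using AutoGroup_inv_apply(1)[OF U_auto[OF f] V_carrier[OF v]] by (simp add: w_def)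
      moreover have "inv (f w \<otimes> inv w) \<in> V (s + k)"
        using subgroup.m_inv_closed[OF V_subgroup U_shift[OF f w]] .
      ultimately show ?thesis
        using V_carrier[OF w] V_carrier[OF v]
        unfolding w_def[symmetric] by (simp add: inv_mult_group)
    qed
    with f' show "inv\<^bsub>Aut\<^esub> f \<in> U k" by (simp add: U_def)
  next
    fix f g assume f: "f \<in> U k" and g: "g \<in> U k"
    have "(f \<otimes>\<^bsub>Aut\<^esub> g) v \<otimes> inv v \<in> V (s + k)" if v: "v \<in> V s" for s v
    proof -
      have "f (g v) \<otimes> inv (g v) \<otimes> (g v \<otimes> inv v) \<in> V (s + k)"
        using U_shift[OF f U_preserves[OF g v]] U_shift[OF g v]
        by (rule subgroup.m_closed[OF V_subgroup])
      moreover have "f (g v) \<otimes> inv (g v) \<otimes> (g v \<otimes> inv v) = f (g v) \<otimes> inv v"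
        using V_carrier[OF v] auto_closed[OF U_auto[OF f]] auto_closed[OF U_auto[OF g]]
        by (simp add: m_assoc inv_cancel_left)
      ultimately show ?thesis
        using AutoGroup_mult_apply[OF U_auto[OF f] U_auto[OF g] V_carrier[OF v]] by simp
    qed
    moreover have "f \<otimes>\<^bsub>Aut\<^esub> g \<in> auto W"
      using U_auto[OF f] U_auto[OF g] Aut.m_closed by (simp add: carrier_AutoGroup)
    ultimately show "f \<otimes>\<^bsub>Aut\<^esub> g \<in> U k" by (simp add: U_def)
  qed
qed

lemma U_antimono: "k \<le> l \<Longrightarrow> U l \<subseteq> U k"
  unfolding U_def using V_antimono[of "s + k" "s + l" for s] by (auto simp: subset_iff)

text \<open>In additive notation let \<open>f = 1 + p\<close> and \<open>g = 1 + q\<close>, so that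
  \<open>p\<close> and \<open>q\<close> raise the filtration by \<open>k\<close> and
  \<open>l\<close>. For \<open>w\<close> the image of \<open>v\<close> under the inverse of
  \<open>g f\<close>, the commutator moves \<open>v = g f w\<close> to \<open>f g w\<close>, and the
  difference is \<open>p q w - q p w\<close>, which lies \<open>k + l\<close> steps deeper.\<close>

lemma U_commutator:
  assumes f: "f \<in> U k" and g: "g \<in> U l"
  shows "f \<otimes>\<^bsub>Aut\<^esub> g \<otimes>\<^bsub>Aut\<^esub> inv\<^bsub>Aut\<^esub> f \<otimes>\<^bsub>Aut\<^esub> inv\<^bsub>Aut\<^esub> g \<in> U (k + l)"
proof -
  interpret Aut: group Aut by (rule AutoGroup)
  have fA: "f \<in> auto W" "inv\<^bsub>Aut\<^esub> f \<in> auto W" and gA: "g \<in> auto W" "inv\<^bsub>Aut\<^esub> g \<in> auto W"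
    using U_auto f g Aut.inv_closed by (simp_all add: carrier_AutoGroup)
  have mA: "a \<otimes>\<^bsub>Aut\<^esub> b \<in> auto W" if "a \<in> auto W" "b \<in> auto W" for a b
    using that Aut.m_closed by (simp add: carrier_AutoGroup)
  define c where "c = f \<otimes>\<^bsub>Aut\<^esub> g \<otimes>\<^bsub>Aut\<^esub> inv\<^bsub>Aut\<^esub> f \<otimes>\<^bsub>Aut\<^esub> inv\<^bsub>Aut\<^esub> g"
  have "c v \<otimes> inv v \<in> V (s + (k + l))" if v: "v \<in> V s" for s v
  proof -
    define w where "w = (inv\<^bsub>Aut\<^esub> f) ((inv\<^bsub>Aut\<^esub> g) v)"
    have w: "w \<in> V s" unfolding w_def by (intro U_inv_preserves[OF f] U_inv_preserves[OF g] v)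
    have wc: "w \<in> carrier W" and vc: "v \<in> carrier W" using V_carrier v w by auto
    have v_eq: "v = g (f w)"
      using AutoGroup_inv_apply(1)[OF fA(1)] AutoGroup_inv_apply(1)[OF gA(1)] auto_closed[OF gA(2)] vc
      by (simp add: w_def)
    have c_eq: "c v = f (g w)"
      using fA gA mA auto_closed vc by (simp add: c_def w_def AutoGroup_mult_apply)
    \<comment> \<open>In that notation \<open>a = p w\<close> and \<open>b = q w\<close>, so the two
      shifts below are \<open>p q w\<close> and \<open>q p w\<close>.\<close>
    define a where "a = f w \<otimes> inv w"
    define b where "b = g w \<otimes> inv w"
    have a: "a \<in> V (s + k)" and b: "b \<in> V (s + l)"
      unfolding a_def b_def by (intro U_shift f g w)+
    have ac: "a \<in> carrier W" and bc: "b \<in> carrier W" using V_carrier a b by auto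
    have fw: "f w = w \<otimes> a" and gw: "g w = w \<otimes> b"
      using auto_closed[OF fA(1) wc] auto_closed[OF gA(1) wc] wc
      by (simp_all add: a_def b_def m_lcomm[of w])
    have "f b \<otimes> inv b \<in> V (s + l + k)" "g a \<otimes> inv a \<in> V (s + k + l)"
      by (intro U_shift f g a b)+
    then have "(f b \<otimes> inv b) \<otimes> inv (g a \<otimes> inv a) \<in> V (s + (k + l))"
      by (simp add: ac_simps subgroup.m_closed[OF V_subgroup] subgroup.m_inv_closed[OF V_subgroup])
    moreover have "c v \<otimes> inv v = (f b \<otimes> inv b) \<otimes> inv (g a \<otimes> inv a)"
    proof -
      have cl: "f b \<in> carrier W" "g a \<in> carrier W" using auto_closed fA(1) gA(1) ac bc by auto
      have cv: "c v = w \<otimes> a \<otimes> f b" and vv: "v = w \<otimes> b \<otimes> g a"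
        unfolding c_eq by (simp_all add: gw auto_mult[OF fA(1) wc bc] fw v_eq auto_mult[OF gA(1) wc ac])
      have "c v = (w \<otimes> a \<otimes> b) \<otimes> (f b \<otimes> inv b)"
        unfolding cv using ac bc wc cl by (simp add: m_assoc m_lcomm[of b])
      moreover have "v = (w \<otimes> a \<otimes> b) \<otimes> (g a \<otimes> inv a)"
        unfolding vv using ac bc wc cl by (simp add: m_assoc m_lcomm[of a] m_comm[of b] inv_cancel_left)
      ultimately show ?thesis
        using mult_inv_mult_cancel[of "w \<otimes> a \<otimes> b" "f b \<otimes> inv b" "g a \<otimes> inv a"] ac bc wc cl by auto
    qed
    ultimately show ?thesis by simp
  qed
  moreover have "c \<in> auto W" unfolding c_def using fA gA mA by simp
  ultimately show ?thesis unfolding c_def[symmetric] by (simp add: U_def)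
qed

text \<open>Taking \<open>s = 0\<close>, a member of \<open>U N\<close> moves every vector by an
  element of the trivial group \<open>V N\<close>.\<close>

lemma U_N: "U N = {\<one>\<^bsub>Aut\<^esub>}"
proof
  show "U N \<subseteq> {\<one>\<^bsub>Aut\<^esub>}"
  proof
    fix f assume f: "f \<in> U N"
    have "f v = v" if v: "v \<in> carrier W" for v
    proof -
      have "f v \<otimes> inv v \<in> V (0 + N)" using U_shift[OF f] v V_0 by blast
      then have "f v \<otimes> inv v = \<one>" by (simp add: V_N)
      then have "inv (inv v) = f v"
        using inv_equality[of "f v" "inv v"] auto_closed[OF U_auto[OF f] v] v by simp
      then show ?thesis using v by simp
    qed
    then have "f = \<one>\<^bsub>Aut\<^esub>"
      using U_auto[OF f] id_in_auto by (intro auto_eqI) (auto simp: one_AutoGroup)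
    then show "f \<in> {\<one>\<^bsub>Aut\<^esub>}" by simp
  qed
qed (use subgroup.one_closed[OF U_subgroup] in simp)

definition Unitri :: "('a \<Rightarrow> 'a) monoid" where
  "Unitri = Aut\<lparr>carrier := U 1\<rparr>"

lemma group_Unitri: "group Unitri"
  unfolding Unitri_def by (rule group.subgroup_imp_group[OF AutoGroup U_subgroup])

lemma carrier_Unitri: "carrier Unitri = U 1"
  and one_Unitri: "\<one>\<^bsub>Unitri\<^esub> = \<one>\<^bsub>Aut\<^esub>"
  and mult_Unitri: "x \<otimes>\<^bsub>Unitri\<^esub> y = x \<otimes>\<^bsub>Aut\<^esub> y"
  by (simp_all add: Unitri_def)

lemma inv_Unitri: "x \<in> U 1 \<Longrightarrow> inv\<^bsub>Unitri\<^esub> x = inv\<^bsub>Aut\<^esub> x"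
  unfolding Unitri_def by (rule group.m_inv_consistent[OF AutoGroup U_subgroup])

lemma finite_Unitri: "finite (carrier Unitri)"
proof (rule finite_subset)
  show "carrier Unitri \<subseteq> carrier (BijGroup (carrier W))"
    using U_auto by (auto simp: carrier_Unitri auto_def BijGroup_def)
  show "finite (carrier (BijGroup (carrier W)))" by (rule finite_BijGroup[OF finite_carrier])
qed

lemma U_subgroup_Unitri:
  assumes "1 \<le> k" shows "subgroup (U k) Unitri"
  unfolding Unitri_def
  by (rule group.subgroup_incl[OF AutoGroup U_subgroup U_subgroup U_antimono[OF assms]])

lemma U_commutator_Unitri:
  assumes "1 \<le> k" "1 \<le> l" "f \<in> U k" "g \<in> U l"
  shows "f \<otimes>\<^bsub>Unitri\<^esub> g \<otimes>\<^bsub>Unitri\<^esub> inv\<^bsub>Unitri\<^esub> f \<otimes>\<^bsub>Unitri\<^esub> inv\<^bsub>Unitri\<^esub> g \<in> U (k + l)"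
proof -
  have "f \<in> U 1" "g \<in> U 1" using assms U_antimono by blast+
  then show ?thesis using U_commutator[OF assms(3,4)] by (simp add: mult_Unitri inv_Unitri)
qed

lemma exp_of_derived_Unitri: "(derived Unitri ^^ m) (carrier Unitri) \<subseteq> U (2 ^ m)"
  by (rule group.exp_of_derived_subset_filtration[OF group_Unitri])
    (auto intro: U_subgroup_Unitri U_commutator_Unitri simp: carrier_Unitri)

lemma lower_central_series_Unitri: "lower_central_series Unitri i \<subseteq> U (Suc i)"
  by (rule group.lower_central_series_subset_filtration[OF group_Unitri])
    (auto intro: U_subgroup_Unitri U_commutator_Unitri simp: carrier_Unitri)

text \<open>The commutator of \<open>c\<close> and \<open>f\<close> lies in
  \<open>U (k + 1) = U N\<close>, which is trivial.\<close>

lemma U_central: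
  assumes "Suc k = N" "1 \<le> k" "c \<in> U k" "f \<in> U 1"
  shows "c \<otimes>\<^bsub>Unitri\<^esub> f = f \<otimes>\<^bsub>Unitri\<^esub> c"
proof -
  interpret T: group Unitri by (rule group_Unitri)
  have cf: "c \<in> carrier Unitri" "f \<in> carrier Unitri" using assms U_antimono by (auto simp: carrier_Unitri)
  have "c \<otimes>\<^bsub>Unitri\<^esub> f \<otimes>\<^bsub>Unitri\<^esub> inv\<^bsub>Unitri\<^esub> c \<otimes>\<^bsub>Unitri\<^esub> inv\<^bsub>Unitri\<^esub> f = \<one>\<^bsub>Unitri\<^esub>"
    using U_commutator_Unitri[of k 1 c f] assms by (simp add: U_N one_Unitri)
  then show ?thesis
    using cf by (metis T.inv_closed T.inv_equality T.inv_inv T.inv_mult_group T.m_assoc T.m_closed)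
qed

end

section \<open>Block matrices over a power of a finite abelian group\<close>

locale power_module = comm_group A for A :: "('a, 'b) monoid_scheme" (structure) +
  fixes n :: nat
  assumes finite_A: "finite (carrier A)"
begin

text \<open>With \<open>2 ^ n + 1\<close> blocks the bound \<open>U (2 ^ n)\<close> for the
  \<open>n\<close>th derived subgroup is the last term before the trivial group \<open>U N\<close>:
  small enough to be central, yet still containing the corner matrices.\<close>

definition N :: nat where "N = Suc (2 ^ n)"

definition I :: "(nat \<times> 'a) set" where "I = {..<N} \<times> carrier A"

definition W :: "(nat \<times> 'a \<Rightarrow> 'a) monoid" where "W = product_group I (\<lambda>_. A)"

definition V :: "nat \<Rightarrow> (nat \<times> 'a \<Rightarrow> 'a) set" where
  "V s = {v \<in> carrier W. \<forall>i x. i < s \<longrightarrow> (i, x) \<in> I \<longrightarrow> v (i, x) = \<one>}"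

lemma W_closed: "v \<in> carrier W \<Longrightarrow> p \<in> I \<Longrightarrow> v p \<in> carrier A"
  by (auto simp: W_def)

lemma W_mult: "p \<in> I \<Longrightarrow> (v \<otimes>\<^bsub>W\<^esub> w) p = v p \<otimes> w p"
  and W_one: "p \<in> I \<Longrightarrow> \<one>\<^bsub>W\<^esub> p = \<one>"
  by (simp_all add: W_def)

lemma W_inv: "v \<in> carrier W \<Longrightarrow> p \<in> I \<Longrightarrow> (inv\<^bsub>W\<^esub> v) p = inv (v p)"
  by (simp add: W_def is_group)

lemma W_eqI: "v \<in> carrier W \<Longrightarrow> w \<in> carrier W \<Longrightarrow> (\<And>p. p \<in> I \<Longrightarrow> v p = w p) \<Longrightarrow> v = w"
  unfolding W_def carrier_product_group by (rule PiE_ext)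

lemma restrict_W: "(\<And>p. p \<in> I \<Longrightarrow> f p \<in> carrier A) \<Longrightarrow> restrict f I \<in> carrier W"
  by (simp add: W_def)

lemma group_W: "group W"
  unfolding W_def by (rule product_group) (rule is_group)

lemma comm_group_W: "comm_group W"
proof (rule group.group_comm_groupI[OF group_W])
  fix v w assume v: "v \<in> carrier W" and w: "w \<in> carrier W"
  then show "v \<otimes>\<^bsub>W\<^esub> w = w \<otimes>\<^bsub>W\<^esub> v"
    by (intro W_eqI) (simp_all add: monoid.m_closed[OF group.is_monoid[OF group_W]] W_mult W_closed m_comm)
qed

sublocale F: filtered_comm_group W V N
proof (intro filtered_comm_group.intro comm_group_W filtered_comm_group_axioms.intro)
  interpret W: comm_group W by (rule comm_group_W)
  show "finite (carrier W)"
    by (simp add: W_def I_def finite_PiE finite_A)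
  show "subgroup (V s) W" for s
  proof (rule W.subgroupI)
    have "\<one>\<^bsub>W\<^esub> \<in> V s" by (auto simp: V_def W_one)
    then show "V s \<noteq> {}" by blast
  qed (auto simp: V_def W_inv W_mult)
  show "V 0 = carrier W" by (simp add: V_def)
  show "V t \<subseteq> V s" if "s \<le> t" for s t using that by (auto simp: V_def)
  show "V N = {\<one>\<^bsub>W\<^esub>}"
  proof (intro equalityI subsetI)
    fix v assume v: "v \<in> V N"
    have "v = \<one>\<^bsub>W\<^esub>"
    proof (rule W_eqI)
      fix p assume p: "p \<in> I"
      obtain i x where ix: "p = (i, x)" by (cases p)
      moreover from p ix have "i < N" by (simp add: I_def)
      ultimately show "v p = \<one>\<^bsub>W\<^esub> p" using v p by (simp add: V_def W_one)
    qed (use v in \<open>auto simp: V_def\<close>)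
    then show "v \<in> {\<one>\<^bsub>W\<^esub>}" by simp
  qed (auto simp: V_def W_one)
qed

text \<open>Elementary matrices: \<open>E i j \<sigma>\<close> adds block \<open>i\<close>, reindexed by \<open>\<sigma>\<close>, to block \<open>j\<close>.\<close>

definition E :: "nat \<Rightarrow> nat \<Rightarrow> ('a \<Rightarrow> 'a) \<Rightarrow> (nat \<times> 'a \<Rightarrow> 'a) \<Rightarrow> (nat \<times> 'a \<Rightarrow> 'a)" where
  "E i j \<sigma> = (\<lambda>v \<in> carrier W. \<lambda>p \<in> I. if fst p = j then v p \<otimes> v (i, \<sigma> (snd p)) else v p)"

lemma index_I: "(j, x) \<in> I \<Longrightarrow> i < j \<Longrightarrow> \<sigma> \<in> carrier A \<rightarrow> carrier A \<Longrightarrow> (i, \<sigma> x) \<in> I"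
  by (auto simp: I_def)

lemma E_closed:
  assumes "i < j" "\<sigma> \<in> carrier A \<rightarrow> carrier A" "v \<in> carrier W"
  shows "E i j \<sigma> v \<in> carrier W"
proof -
  have "(if fst p = j then v p \<otimes> v (i, \<sigma> (snd p)) else v p) \<in> carrier A" if "p \<in> I" for p
    using that assms index_I[of j "snd p" i \<sigma>] by (cases p) (auto simp: W_closed)
  then show ?thesis using assms(3) by (simp add: E_def restrict_W)
qed

lemma E_apply:
  assumes "v \<in> carrier W" "(l, x) \<in> I"
  shows "E i j \<sigma> v (l, x) = (if l = j then v (l, x) \<otimes> v (i, \<sigma> x) else v (l, x))"
  using assms by (simp add: E_def)

lemma E_auto:
  assumes ij: "i < j" and \<sigma>: "\<sigma> \<in> carrier A \<rightarrow> carrier A"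
  shows "E i j \<sigma> \<in> auto W"
proof -
  have "E i j \<sigma> (v \<otimes>\<^bsub>W\<^esub> w) = E i j \<sigma> v \<otimes>\<^bsub>W\<^esub> E i j \<sigma> w" if v: "v \<in> carrier W" and w: "w \<in> carrier W" for v w
  proof (rule W_eqI)
    fix p assume p: "p \<in> I"
    obtain l x where lx: "p = (l, x)" by (cases p)
    have "(i, \<sigma> x) \<in> I" if "l = j" using p lx ij \<sigma> that by (auto intro: index_I)
    then show "E i j \<sigma> (v \<otimes>\<^bsub>W\<^esub> w) p = (E i j \<sigma> v \<otimes>\<^bsub>W\<^esub> E i j \<sigma> w) p"
      using p v w unfolding lx
      by (auto simp: E_apply W_mult W_closed m_ac)
  qed (use v w ij \<sigma> in \<open>auto intro!: E_closed\<close>)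
  then have hom: "E i j \<sigma> \<in> hom W W"
    using E_closed[OF ij \<sigma>] by (intro homI) auto
  have inj: "inj_on (E i j \<sigma>) (carrier W)"
  \<comment> \<open>Only block \<open>j\<close> changes. Block \<open>i\<close>, which lies strictly
    before it, can be read off the image, and then block \<open>j\<close> is recovered by
    cancellation; surjectivity follows from finiteness.\<close>
  proof (rule inj_onI)
    fix v w assume v: "v \<in> carrier W" and w: "w \<in> carrier W" and eq: "E i j \<sigma> v = E i j \<sigma> w"
    have off: "v (l, x) = w (l, x)" if "(l, x) \<in> I" "l \<noteq> j" for l x
      using fun_cong[OF eq, of "(l, x)"] that v w by (simp add: E_apply)
    show "v = w"
    proof (rule W_eqI[OF v w])
      fix p assume p: "p \<in> I"
      obtain l x where lx: "p = (l, x)" by (cases p)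
      show "v p = w p"
      proof (cases "l = j")
        case True
        then have i: "(i, \<sigma> x) \<in> I" using p lx ij \<sigma> by (auto intro: index_I)
        then show ?thesis
          using fun_cong[OF eq, of p] p v w off[OF i] ij W_closed[OF v] W_closed[OF w] True
          by (simp add: lx E_apply)
      qed (use off p lx in simp)
    qed
  qed
  moreover have "E i j \<sigma> ` carrier W \<subseteq> carrier W" using E_closed[OF ij \<sigma>] by blast
  ultimately have "bij_betw (E i j \<sigma>) (carrier W) (carrier W)"
    using F.finite_carrier by (simp add: bij_betw_def endo_inj_surj)
  then show ?thesis using hom by (simp add: auto_def Bij_def E_def)
qed

lemma E_in_U:
  assumes ij: "i < j" and \<sigma>: "\<sigma> \<in> carrier A \<rightarrow> carrier A" and k: "k \<le> j - i"
  shows "E i j \<sigma> \<in> F.U k"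
proof -
  have "E i j \<sigma> v \<otimes>\<^bsub>W\<^esub> inv\<^bsub>W\<^esub> v \<in> V (s + k)" if v: "v \<in> V s" for s v
  proof -
    have vc: "v \<in> carrier W" using v by (simp add: V_def)
    have "(E i j \<sigma> v \<otimes>\<^bsub>W\<^esub> inv\<^bsub>W\<^esub> v) (l, x) = \<one>" if l: "l < s + k" "(l, x) \<in> I" for l x
    proof (cases "l = j")
      case True
      then have i: "(i, \<sigma> x) \<in> I" using l ij \<sigma> by (auto intro: index_I)
      \<comment> \<open>From \<open>j < s + k\<close> and \<open>k \<le> j - i\<close> it follows
        that \<open>i < s\<close>, so the block added to block \<open>j\<close> vanishes on
        \<open>V s\<close>.\<close>
      moreover have "i < s" using True l k ij by simp
      ultimately have "v (i, \<sigma> x) = \<one>" using v by (simp add: V_def)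
      then show ?thesis using l vc W_closed[OF vc l(2)] True by (auto simp: W_mult W_inv E_apply)
    qed (use l vc in \<open>simp add: W_mult W_inv E_apply W_closed\<close>)
    then show ?thesis
      using E_closed[OF ij \<sigma> vc] vc by (simp add: V_def)
  qed
  then show ?thesis using E_auto[OF ij \<sigma>] by (simp add: F.U_def)
qed

lemma E_commutator:
  assumes ij: "i < j" and jk: "j < k" and \<sigma>: "\<sigma> \<in> carrier A \<rightarrow> carrier A"
  defines "x \<equiv> E j k (\<lambda>x. x)" and "y \<equiv> E i j \<sigma>"
  shows "x \<otimes>\<^bsub>F.Unitri\<^esub> y \<otimes>\<^bsub>F.Unitri\<^esub> inv\<^bsub>F.Unitri\<^esub> x \<otimes>\<^bsub>F.Unitri\<^esub> inv\<^bsub>F.Unitri\<^esub> y = E i k \<sigma>"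
proof -
  interpret T: group F.Unitri by (rule F.group_Unitri)
  let ?z = "E i k \<sigma>"
  have id: "(\<lambda>x. x) \<in> carrier A \<rightarrow> carrier A" and ik: "i < k" using ij jk by auto
  have U: "x \<in> F.U 1" "y \<in> F.U 1" "?z \<in> F.U 1"
    unfolding x_def y_def using ij jk ik \<sigma> id by (auto intro!: E_in_U)
  then have car: "x \<in> carrier F.Unitri" "y \<in> carrier F.Unitri" "?z \<in> carrier F.Unitri"
    by (simp_all add: F.carrier_Unitri)
  \<comment> \<open>The multiplied-out relation can be checked on coordinates without computing
    inverses: applying \<open>y\<close> before \<open>x\<close> carries block \<open>i\<close>
    through block \<open>j\<close> into block \<open>k\<close>, which the opposite order does not
    do.\<close>
  have "x \<otimes>\<^bsub>F.Unitri\<^esub> y = ?z \<otimes>\<^bsub>F.Unitri\<^esub> (y \<otimes>\<^bsub>F.Unitri\<^esub> x)"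
  proof (rule F.auto_eqI)
    show "x \<otimes>\<^bsub>F.Unitri\<^esub> y \<in> auto W" "?z \<otimes>\<^bsub>F.Unitri\<^esub> (y \<otimes>\<^bsub>F.Unitri\<^esub> x) \<in> auto W"
      using car T.m_closed by (auto simp: F.carrier_Unitri intro!: F.U_auto[of _ 1])
    fix v assume v: "v \<in> carrier W"
    have appl: "(f \<otimes>\<^bsub>F.Unitri\<^esub> g) v = f (g v)" if "f \<in> carrier F.Unitri" "g \<in> carrier F.Unitri" for f g
      unfolding F.mult_Unitri using that v
      by (intro F.AutoGroup_mult_apply) (auto simp: F.carrier_Unitri intro!: F.U_auto[of _ 1])
    have "x (y v) = ?z (y (x v))"
    proof (rule W_eqI)
      fix p assume p: "p \<in> I"
      obtain l u where lu: "p = (l, u)" by (cases p)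
      have c: "y v \<in> carrier W" "x v \<in> carrier W" "y (x v) \<in> carrier W"
        unfolding x_def y_def using ij jk \<sigma> id v by (auto intro!: E_closed)
      have i1: "(j, u) \<in> I" "(i, \<sigma> u) \<in> I" if "l = k"
        using p lu jk ik \<sigma> that id by (auto intro: index_I index_I[of k u j "\<lambda>x. x", simplified])
      have i2: "(i, \<sigma> u) \<in> I" if "l = j"
        using p lu ij \<sigma> that by (auto intro: index_I)
      show "x (y v) p = ?z (y (x v)) p"
        using p v c i1 i2 ij jk W_closed[OF v] unfolding lu x_def y_def
        by (auto simp: E_apply m_assoc)
    qed (use ij jk ik \<sigma> id v in \<open>auto simp: x_def y_def intro!: E_closed\<close>)
    then show "(x \<otimes>\<^bsub>F.Unitri\<^esub> y) v = (?z \<otimes>\<^bsub>F.Unitri\<^esub> (y \<otimes>\<^bsub>F.Unitri\<^esub> x)) v"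
      using appl car by simp
  qed
  then show ?thesis
    using car by (simp add: T.m_assoc T.inv_cancel_left)
qed

definition D :: "((nat \<times> 'a \<Rightarrow> 'a) \<Rightarrow> (nat \<times> 'a \<Rightarrow> 'a)) set" where
  "D = (derived F.Unitri ^^ n) (carrier F.Unitri)"

text \<open>A matrix at distance \<open>2 ^ Suc m\<close> is the commutator of two at distance
  \<open>2 ^ m\<close> that meet in block \<open>i + 2 ^ m\<close>. One factor carries
  \<open>\<sigma>\<close> and the other the identity reindexing, hence the induction over arbitrary
  \<open>i\<close> and \<open>\<sigma>\<close>.\<close>

lemma E_in_exp_of_derived:
  assumes "\<sigma> \<in> carrier A \<rightarrow> carrier A"
  shows "E i (i + 2 ^ m) \<sigma> \<in> (derived F.Unitri ^^ m) (carrier F.Unitri)"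
  using assms
proof (induction m arbitrary: i \<sigma>)
  case 0
  then show ?case by (auto simp: F.carrier_Unitri intro!: E_in_U)
next
  case (Suc m)
  have "E i (i + 2 ^ Suc m) \<sigma> \<in> derived_set F.Unitri ((derived F.Unitri ^^ m) (carrier F.Unitri))"
    using E_commutator[of i "i + 2 ^ m" "i + 2 ^ m + 2 ^ m" \<sigma>] Suc.prems
      Suc.IH[OF Suc.prems, of i] Suc.IH[of "\<lambda>x. x" "i + 2 ^ m"]
    by (force simp: mult_2 add.assoc)
  then show ?case
    unfolding funpow.simps comp_apply
      derived_def[of F.Unitri "(derived F.Unitri ^^ m) (carrier F.Unitri)"]
    by (rule generate.incl)
qed

lemma D_subset_U: "D \<subseteq> F.U (2 ^ n)"
  unfolding D_def by (rule F.exp_of_derived_Unitri)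

text \<open>Since \<open>N = Suc (2 ^ n)\<close>, the group \<open>U (2 ^ n)\<close> containing
  \<open>D\<close> is the one to which \<open>U_central\<close> applies.\<close>

lemma D_central: "D \<subseteq> centre F.Unitri"
proof
  fix c assume "c \<in> D"
  then have c: "c \<in> F.U (2 ^ n)" using D_subset_U by blast
  then have "c \<in> carrier F.Unitri" using F.U_antimono[of 1 "2 ^ n"] by (auto simp: F.carrier_Unitri)
  moreover have "c \<otimes>\<^bsub>F.Unitri\<^esub> f = f \<otimes>\<^bsub>F.Unitri\<^esub> c" if "f \<in> carrier F.Unitri" for f
    using F.U_central[of "2 ^ n" c f] c that by (simp add: N_def F.carrier_Unitri)
  ultimately show "c \<in> centre F.Unitri" by (simp add: centre_def)
qed

text \<open>The blocks are indexed by \<open>A\<close> in order that \<open>w0\<close> has every element of \<open>A\<close> as a coordinate. Adding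
  the coordinate \<open>a\<close> of block \<open>0\<close> to the last block then makes \<open>\<iota>\<close> take the value \<open>a\<close>, which shows
  surjectivity also when \<open>A\<close> is not cyclic.\<close>

definition w0 :: "nat \<times> 'a \<Rightarrow> 'a" where
  "w0 = (\<lambda>p \<in> I. if fst p = 0 then snd p else \<one>)"

text \<open>This reads one coordinate of the displacement of \<open>w0\<close>. Blocks are numbered
  from 0, so \<open>2 ^ n\<close> is the last one; \<open>\<one>\<close> merely selects a fixed
  coordinate of it.\<close>

definition \<iota> :: "((nat \<times> 'a \<Rightarrow> 'a) \<Rightarrow> (nat \<times> 'a \<Rightarrow> 'a)) \<Rightarrow> 'a" where
  "\<iota> f = (f w0 \<otimes>\<^bsub>W\<^esub> inv\<^bsub>W\<^esub> w0) (2 ^ n, \<one>)"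

lemma w0: "w0 \<in> carrier W"
  unfolding w0_def by (rule restrict_W) (auto simp: I_def)

lemma corner: "(2 ^ n, \<one>) \<in> I"
  by (simp add: I_def N_def)

lemma \<iota>_hom: "\<iota> \<in> hom (F.Unitri\<lparr>carrier := D\<rparr>) A"
proof (rule homI)
  fix f assume "f \<in> carrier (F.Unitri\<lparr>carrier := D\<rparr>)"
  then have f: "f \<in> F.U (2 ^ n)" using D_subset_U by auto
  then show "\<iota> f \<in> carrier A"
    unfolding \<iota>_def using w0 corner F.auto_closed[OF F.U_auto] by (simp add: W_closed)
next
  fix f g assume "f \<in> carrier (F.Unitri\<lparr>carrier := D\<rparr>)" "g \<in> carrier (F.Unitri\<lparr>carrier := D\<rparr>)"
  then have f: "f \<in> F.U (2 ^ n)" and g: "g \<in> F.U (2 ^ n)" using D_subset_U by auto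
  have fA: "f \<in> auto W" and gA: "g \<in> auto W" using f g by (auto intro: F.U_auto)
  have fw: "f w0 \<in> carrier W" and gw: "g w0 \<in> carrier W" using fA gA w0 F.auto_closed by auto
  define b where "b = g w0 \<otimes>\<^bsub>W\<^esub> inv\<^bsub>W\<^esub> w0"
  have b: "b \<in> V (2 ^ n)"
    using F.U_shift[OF g, of w0 0] w0 F.V_0 by (simp add: b_def)
  have bc: "b \<in> carrier W" using F.V_carrier[OF b] .
  have fbc: "f b \<in> carrier W" using F.auto_closed[OF fA bc] .
  \<comment> \<open>Because \<open>2 ^ n + 2 ^ n\<close> is at least \<open>N\<close>, also for
    \<open>n = 0\<close>, the displacement \<open>b\<close> of \<open>w0\<close> under
    \<open>g\<close> is fixed by \<open>f\<close>. Displacements under \<open>f\<close> and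
    \<open>g\<close> therefore simply multiply.\<close>
  have "f b \<otimes>\<^bsub>W\<^esub> inv\<^bsub>W\<^esub> b \<in> V N"
    using F.U_shift[OF f b] F.V_antimono[of N "2 ^ n + 2 ^ n"] by (auto simp: N_def Suc_leI)
  then have "f b = b"
    using F.V_N fbc bc by (metis F.inv_closed F.inv_equality F.inv_inv singletonD)
  moreover have "g w0 = w0 \<otimes>\<^bsub>W\<^esub> b" using gw w0 by (simp add: b_def F.m_lcomm[of w0])
  ultimately have "(f \<otimes>\<^bsub>F.Unitri\<^esub> g) w0 = f w0 \<otimes>\<^bsub>W\<^esub> b"
    using F.auto_mult[OF fA w0 bc] F.AutoGroup_mult_apply[OF fA gA w0] by (simp add: F.mult_Unitri)
  then have "(f \<otimes>\<^bsub>F.Unitri\<^esub> g) w0 \<otimes>\<^bsub>W\<^esub> inv\<^bsub>W\<^esub> w0 = (f w0 \<otimes>\<^bsub>W\<^esub> inv\<^bsub>W\<^esub> w0) \<otimes>\<^bsub>W\<^esub> b"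
    using fw bc w0 by (simp add: F.m_ac)
  then show "\<iota> (f \<otimes>\<^bsub>F.Unitri\<lparr>carrier := D\<rparr>\<^esub> g) = \<iota> f \<otimes> \<iota> g"
    by (simp add: \<iota>_def b_def W_mult corner)
qed

lemma \<iota>_surj: "carrier A \<subseteq> \<iota> ` D"
proof
  fix a assume a: "a \<in> carrier A"
  \<comment> \<open>The constant reindexing copies coordinate \<open>a\<close> of block 0 to every
    coordinate of the last block, in particular to the one read by \<open>\<iota>\<close>.\<close>
  let ?e = "E 0 (2 ^ n) (\<lambda>_. a)"
  have "?e \<in> D" unfolding D_def using E_in_exp_of_derived[of "\<lambda>_. a" 0 n] a by simp
  moreover have "\<iota> ?e = a"
  proof -
    have "(0, a) \<in> I" using a by (simp add: I_def N_def)
    then show ?thesis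
      unfolding \<iota>_def using w0 corner a by (simp add: W_mult W_inv E_apply) (simp add: w0_def)
  qed
  ultimately show "a \<in> \<iota> ` D" by (metis imageI)
qed

end

text \<open>This collects what is needed of the unitriangular group, to be applied to the abelian
  factor of a central product. The map \<open>\<iota>\<close> may have a kernel, which is divided
  out afterwards; the bound on the lower central series serves nilpotency.\<close>

lemma (in comm_group) ex_integral_up_to_central_quotient:
  assumes "finite (carrier G)"
  shows "\<exists>(T :: ((nat \<times> 'a \<Rightarrow> 'a) \<Rightarrow> nat \<times> 'a \<Rightarrow> 'a) monoid) \<iota>.
    group T \<and> finite (carrier T) \<and> lower_central_series T (2 ^ n) \<subseteq> {\<one>\<^bsub>T\<^esub>} \<and>
    (derived T ^^ n) (carrier T) \<subseteq> centre T \<and>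
    \<iota> \<in> hom (T\<lparr>carrier := (derived T ^^ n) (carrier T)\<rparr>) G \<and>
    carrier G \<subseteq> \<iota> ` (derived T ^^ n) (carrier T)"
proof -
  interpret M: power_module G n
    by (intro power_module.intro power_module_axioms.intro comm_group_axioms assms)
  \<comment> \<open>Term \<open>2 ^ n\<close> lies in \<open>U (Suc (2 ^ n)) = U N\<close>.\<close>
  have "lower_central_series M.F.Unitri (2 ^ n) \<subseteq> {\<one>\<^bsub>M.F.Unitri\<^esub>}"
    using M.F.lower_central_series_Unitri[of "2 ^ n"] M.F.U_N
    by (simp add: M.N_def M.F.one_Unitri)
  then show ?thesis
    using M.F.group_Unitri M.F.finite_Unitri M.D_central M.\<iota>_hom M.\<iota>_surj
    unfolding M.D_def by blast
qed

section \<open>Lower central series of images and direct products\<close>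

lemma (in group_hom) commutator_subgroup_img:
  assumes K: "K \<subseteq> carrier G" and L: "L \<subseteq> carrier G"
  shows "commutator_subgroup H (h ` K) (h ` L) = h ` commutator_subgroup G K L"
proof -
  let ?S = "\<Union>x \<in> K. \<Union>y \<in> L. {x \<otimes>\<^bsub>G\<^esub> y \<otimes>\<^bsub>G\<^esub> inv\<^bsub>G\<^esub> x \<otimes>\<^bsub>G\<^esub> inv\<^bsub>G\<^esub> y}"
  have eq: "h (x \<otimes>\<^bsub>G\<^esub> y \<otimes>\<^bsub>G\<^esub> inv\<^bsub>G\<^esub> x \<otimes>\<^bsub>G\<^esub> inv\<^bsub>G\<^esub> y)
      = h x \<otimes>\<^bsub>H\<^esub> h y \<otimes>\<^bsub>H\<^esub> inv\<^bsub>H\<^esub> h x \<otimes>\<^bsub>H\<^esub> inv\<^bsub>H\<^esub> h y" if "x \<in> K" "y \<in> L" for x y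
    using that K L by (simp add: subset_iff)
  have "(\<Union>x \<in> h ` K. \<Union>y \<in> h ` L. {x \<otimes>\<^bsub>H\<^esub> y \<otimes>\<^bsub>H\<^esub> inv\<^bsub>H\<^esub> x \<otimes>\<^bsub>H\<^esub> inv\<^bsub>H\<^esub> y}) = h ` ?S"
    by (simp add: image_UN eq cong: SUP_cong_simp)
  moreover have "?S \<subseteq> carrier G" using K L by (auto simp: subset_iff)
  ultimately show ?thesis unfolding commutator_subgroup_def by (simp add: generate_img)
qed

lemma (in group) lower_central_series_in_carrier: "lower_central_series G i \<subseteq> carrier G"
proof (induction i)
  case (Suc i)
  then show ?case
    unfolding lower_central_series.simps commutator_subgroup_def
    by (intro generate_incl) (auto simp: subset_iff)
qed simp

lemma (in group_hom) lower_central_series_img: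
  assumes "h ` carrier G = carrier H"
  shows "lower_central_series H i = h ` lower_central_series G i"
proof (induction i)
  case (Suc i)
  then show ?case
    using commutator_subgroup_img[OF G.lower_central_series_in_carrier order_refl, of i] assms by simp
qed (use assms in simp)

lemma (in group) one_in_lower_central_series: "\<one> \<in> lower_central_series G i"
  by (cases i) (simp_all add: commutator_subgroup_def generate.one)

lemma (in comm_group) lower_central_series_trivial:
  assumes "0 < i" shows "lower_central_series G i \<subseteq> {\<one>}"
proof -
  obtain j where j: "i = Suc j" using assms by (cases i) auto
  have "(\<Union>x \<in> lower_central_series G j. \<Union>y \<in> carrier G. {x \<otimes> y \<otimes> inv x \<otimes> inv y}) \<subseteq> {\<one>}"
  proof (clarsimp)
    fix x y assume "x \<in> lower_central_series G j" and y: "y \<in> carrier G"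
    then have "x \<in> carrier G" using lower_central_series_in_carrier by blast
    with y show "x \<otimes> y \<otimes> inv x \<otimes> inv y = \<one>" by (simp add: m_comm[of x y] m_assoc inv_cancel_left)
  qed
  then show ?thesis
    unfolding j lower_central_series.simps commutator_subgroup_def
    by (rule generate_subgroup_incl[OF _ triv_subgroup])
qed

text \<open>Both projections are surjective, so they carry the series of the product onto the series
  of the factors.\<close>

lemma lower_central_series_DirProd:
  assumes "group G" "group T"
  shows "lower_central_series (G \<times>\<times> T) i \<subseteq> lower_central_series G i \<times> lower_central_series T i"
proof -
  have P: "group (G \<times>\<times> T)" using assms by (rule DirProd_group)
  have ne: "carrier G \<noteq> {}" "carrier T \<noteq> {}"
    using assms by (auto dest: group.is_monoid monoid.one_closed)
  interpret p1: group_hom "G \<times>\<times> T" G fst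
    by (intro group_hom.intro group_hom_axioms.intro P assms homI) (auto simp: mult_DirProd')
  interpret p2: group_hom "G \<times>\<times> T" T snd
    by (intro group_hom.intro group_hom_axioms.intro P assms homI) (auto simp: mult_DirProd')
  show ?thesis
    using p1.lower_central_series_img[of i] p2.lower_central_series_img[of i] ne
    by (force simp: fst_image_times snd_image_times)
qed

lemma centre_DirProd: "centre G \<times> centre T \<subseteq> centre (G \<times>\<times> T)"
proof clarify
  fix a c assume a: "a \<in> centre G" and c: "c \<in> centre T"
  have "(a, c) \<otimes>\<^bsub>G \<times>\<times> T\<^esub> (x, y) = (x, y) \<otimes>\<^bsub>G \<times>\<times> T\<^esub> (a, c)"
    if "x \<in> carrier G" "y \<in> carrier T" for x y
    unfolding mult_DirProd using a c that unfolding centre_def by blast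
  then show "(a, c) \<in> centre (G \<times>\<times> T)"
    using a c unfolding centre_def carrier_DirProd by blast
qed

section \<open>Integrals of central products by amalgamation\<close>

lemma (in group) exp_of_derived_perfect:
  assumes "subgroup N G" "perfect_group (G\<lparr>carrier := N\<rparr>)"
  shows "(derived G ^^ n) N = N"
proof -
  have "derived G N = N"
    using assms derived_consistent[OF order_refl assms(1)] by (simp add: perfect_group_def)
  then show ?thesis by (induction n) simp_all
qed

text \<open>An element of \<open>A\<close> commutes with \<open>N\<close> by the commutator
  condition and with \<open>A\<close> by commutativity, hence with every product
  \<open>x \<otimes> b\<close>.\<close>

lemma (in group) central_product_imp_central:
  assumes "central_product G N A" "comm_group (G\<lparr>carrier := A\<rparr>)"
  shows "A \<subseteq> centre G"
proof
  fix a assume a: "a \<in> A"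
  have nN: "N \<lhd> G" and nA: "A \<lhd> G" and G: "carrier G = N <#> A"
    and com: "commutator_subgroup G N A = {\<one>}"
    using assms(1) by (simp_all add: central_product_def)
  interpret N: normal N G by fact
  interpret A: normal A G by fact
  have aG: "a \<in> carrier G" using a A.subset by blast
  have "a \<otimes> g = g \<otimes> a" if gG: "g \<in> carrier G" for g
  proof -
    obtain x b where x: "x \<in> N" and b: "b \<in> A" and g: "g = x \<otimes> b"
      using gG unfolding G set_mult_def by blast
    have xG: "x \<in> carrier G" and bG: "b \<in> carrier G" using x b N.subset A.subset by auto
    have "x \<otimes> a \<otimes> inv x \<otimes> inv a \<in> commutator_subgroup G N A"
      unfolding commutator_subgroup_def by (rule generate.incl) (use x a in blast)
    then have "x \<otimes> a \<otimes> inv x \<otimes> inv a = \<one>" using com by simp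
    then have 1: "x \<otimes> a = a \<otimes> x"
      using aG xG by (metis inv_closed inv_equality inv_inv inv_mult_group m_assoc m_closed)
    have 2: "b \<otimes> a = a \<otimes> b"
      using comm_monoid.m_comm[OF comm_group.axioms(1)[OF assms(2)], of a b] a b by simp
    show "a \<otimes> g = g \<otimes> a"
      unfolding g using 1 2 aG xG bG by (metis m_assoc)
  qed
  with aG show "a \<in> centre G" unfolding centre_def by blast
qed

lemma (in group) central_product_integral:
  assumes fin: "finite (carrier G)" and cp: "central_product G N A"
    and perf: "perfect_group (G\<lparr>carrier := N\<rparr>)" and comA: "comm_group (G\<lparr>carrier := A\<rparr>)"
  shows "\<exists>K :: ('a \<times> ((nat \<times> 'a \<Rightarrow> 'a) \<Rightarrow> nat \<times> 'a \<Rightarrow> 'a)) set monoid.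
    group K \<and> finite (carrier K) \<and> nth_derived_group n K \<cong> G \<and>
    (comm_group G \<longrightarrow> nilpotent_group K)"
proof -
  have nN: "N \<lhd> G" and nA: "A \<lhd> G" and GNA: "carrier G = N <#> A"
    using cp by (simp_all add: central_product_def)
  interpret N: normal N G by fact
  interpret A: normal A G by fact
  have A_centre: "A \<subseteq> centre G" by (rule central_product_imp_central[OF cp comA])
  have finA: "finite (carrier (G\<lparr>carrier := A\<rparr>))"
    using finite_subset[OF A.subset fin] by simp
  obtain T :: "((nat \<times> 'a \<Rightarrow> 'a) \<Rightarrow> nat \<times> 'a \<Rightarrow> 'a) monoid" and \<iota> where
    T: "group T" "finite (carrier T)" "lower_central_series T (2 ^ n) \<subseteq> {\<one>\<^bsub>T\<^esub>}"
      "(derived T ^^ n) (carrier T) \<subseteq> centre T" and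
    \<iota>: "\<iota> \<in> hom (T\<lparr>carrier := (derived T ^^ n) (carrier T)\<rparr>) (G\<lparr>carrier := A\<rparr>)"
      "carrier (G\<lparr>carrier := A\<rparr>) \<subseteq> \<iota> ` (derived T ^^ n) (carrier T)"
    using comm_group.ex_integral_up_to_central_quotient[OF comA finA, of n] by auto
  interpret T: group T by fact
  define D where "D = (derived T ^^ n) (carrier T)"
  have sD: "subgroup D T" unfolding D_def by (intro T.exp_of_derived_is_subgroup T.subgroup_self)
  interpret D: subgroup D T by fact
  have \<iota>A: "\<iota> c \<in> A" if "c \<in> D" for c using \<iota>(1) that by (auto simp: hom_def D_def)
  have \<iota>_surj: "\<exists>c \<in> D. a = \<iota> c" if "a \<in> A" for a
    using \<iota>(2) that unfolding D_def by auto
  interpret \<iota>: group_hom "T\<lparr>carrier := D\<rparr>" G \<iota>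
    by (intro group_hom.intro group_hom_axioms.intro T.subgroup_imp_group sD is_group homI)
      (use \<iota>(1) A.subset in \<open>auto simp: hom_def D_def Pi_iff subset_iff\<close>)
  have \<iota>_mult: "\<iota> (c \<otimes>\<^bsub>T\<^esub> d) = \<iota> c \<otimes> \<iota> d" if "c \<in> D" "d \<in> D" for c d
    using \<iota>.hom_mult that by simp
  have \<iota>_inv: "\<iota> (inv\<^bsub>T\<^esub> c) = inv (\<iota> c)" if "c \<in> D" for c
    using \<iota>.hom_inv[of c] that T.m_inv_consistent[OF sD that] by simp
  have \<iota>_one: "\<iota> \<one>\<^bsub>T\<^esub> = \<one>" using \<iota>.hom_one by simp
  have \<iota>G: "\<iota> c \<in> carrier G" if "c \<in> D" for c using \<iota>A[OF that] A.subset by blast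

  let ?P = "G \<times>\<times> T"
  interpret P: group ?P by (intro DirProd_group is_group T.is_group)
  interpret j1: group_hom G ?P "\<lambda>g. (g, \<one>\<^bsub>T\<^esub>)"
    by (intro group_hom.intro group_hom_axioms.intro is_group P.is_group homI) auto
  interpret j2: group_hom T ?P "\<lambda>t. (\<one>, t)"
    by (intro group_hom.intro group_hom_axioms.intro T.is_group P.is_group homI) auto
  interpret p2: group_hom ?P T snd
    by (intro group_hom.intro group_hom_axioms.intro T.is_group P.is_group homI) (auto simp: mult_DirProd')

  \<comment> \<open>Modulo \<open>Z\<close> the elements \<open>(\<one>, c)\<close> and
    \<open>(\<iota> c, \<one>)\<close> agree, and the kernel of \<open>\<iota>\<close> is killed.
    \<open>Z\<close> is closed under products because the values of \<open>\<iota>\<close> commute,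
    and it is normal because it is central in both coordinates.\<close>
  define Z where "Z = (\<lambda>c. (inv (\<iota> c), c)) ` D"
  have sZ: "subgroup Z ?P"
  proof (rule P.subgroupI)
    show "Z \<subseteq> carrier ?P" using \<iota>G D.subset by (auto simp: Z_def)
    show "Z \<noteq> {}" unfolding Z_def using D.one_closed by blast
    fix x assume "x \<in> Z"
    then obtain c where c: "c \<in> D" "x = (inv (\<iota> c), c)" by (auto simp: Z_def)
    have "inv\<^bsub>?P\<^esub> x = (inv (\<iota> (inv\<^bsub>T\<^esub> c)), inv\<^bsub>T\<^esub> c)"
      using c \<iota>G D.subset by (auto simp: \<iota>_inv is_group T.is_group subset_iff)
    then show "inv\<^bsub>?P\<^esub> x \<in> Z" unfolding Z_def using c(1) by blast
    fix y assume "y \<in> Z"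
    then obtain d where d: "d \<in> D" "y = (inv (\<iota> d), d)" by (auto simp: Z_def)
    have "\<iota> c \<otimes> \<iota> d = \<iota> d \<otimes> \<iota> c"
      using A_centre \<iota>A[OF c(1)] \<iota>G[OF d(1)] unfolding centre_def by blast
    then have "x \<otimes>\<^bsub>?P\<^esub> y = (inv (\<iota> (c \<otimes>\<^bsub>T\<^esub> d)), c \<otimes>\<^bsub>T\<^esub> d)"
      using c d \<iota>G by (simp add: \<iota>_mult inv_mult_group)
    then show "x \<otimes>\<^bsub>?P\<^esub> y \<in> Z" unfolding Z_def using c(1) d(1) by blast
  qed
  have "Z \<subseteq> centre G \<times> centre T"
  proof
    fix x assume "x \<in> Z"
    then obtain c where c: "c \<in> D" "x = (inv (\<iota> c), c)" by (auto simp: Z_def)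
    have "inv (\<iota> c) \<in> A" using \<iota>A[OF c(1)] by (rule A.m_inv_closed)
    then show "x \<in> centre G \<times> centre T"
      using A_centre T(4) c by (auto simp: D_def)
  qed
  then have "Z \<subseteq> centre ?P" using centre_DirProd by (rule order_trans)
  then have nZ: "Z \<lhd> ?P" by (rule P.subset_centre_normal[OF sZ])
  interpret Z: normal Z ?P by fact

  note [simp del] = N.mem_carrier A.mem_carrier D.mem_carrier Z.mem_carrier

  define K where "K = ?P Mod Z"
  have K: "group K" unfolding K_def by (rule Z.factorgroup_is_group)
  define \<pi> where "\<pi> = (\<lambda>x. Z #>\<^bsub>?P\<^esub> x)"
  interpret \<pi>: group_hom ?P K \<pi>
    unfolding K_def \<pi>_def
    by (intro group_hom.intro group_hom_axioms.intro P.is_group Z.factorgroup_is_group Z.r_coset_hom_Mod)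
  have \<pi>_surj: "\<pi> ` carrier ?P = carrier K"
    by (auto simp: \<pi>_def K_def FactGroup_def RCOSETS_def)
  have \<pi>_one_iff: "\<pi> x = \<one>\<^bsub>K\<^esub> \<longleftrightarrow> x \<in> Z" if "x \<in> carrier ?P" for x
    using that P.coset_join1[OF _ that sZ] P.coset_join2[OF that sZ]
    by (auto simp: \<pi>_def K_def FactGroup_def)
  have \<pi>_Z: "\<pi> (x \<otimes>\<^bsub>?P\<^esub> z) = \<pi> x" if "x \<in> carrier ?P" "z \<in> Z" for x z
  proof -
    have z: "z \<in> carrier ?P" using that(2) Z.subset by (rule subsetD[rotated])
    have "\<pi> (x \<otimes>\<^bsub>?P\<^esub> z) = \<pi> x \<otimes>\<^bsub>K\<^esub> \<pi> z" by (rule \<pi>.hom_mult[OF that(1) z])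
    also have "\<pi> z = \<one>\<^bsub>K\<^esub>" using \<pi>_one_iff[OF z] that(2) by blast
    also have "\<pi> x \<otimes>\<^bsub>K\<^esub> \<one>\<^bsub>K\<^esub> = \<pi> x" by (rule \<pi>.H.r_one[OF \<pi>.hom_closed[OF that(1)]])
    finally show ?thesis .
  qed

  \<comment> \<open>\<open>Q\<close> is only enclosed: it contains the copies of \<open>N\<close>
    and \<open>D\<close> and lies in \<open>carrier G \<times> D\<close>. Modulo \<open>Z\<close>
    this determines it, since \<open>D\<close> becomes \<open>A\<close> and \<open>G\<close> is the
    product of \<open>N\<close> and \<open>A\<close>.\<close>
  define Q where "Q = (derived ?P ^^ n) (carrier ?P)"
  have sQ: "subgroup Q ?P" unfolding Q_def by (intro P.exp_of_derived_is_subgroup P.subgroup_self)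
  have QN: "(x, \<one>\<^bsub>T\<^esub>) \<in> Q" if "x \<in> N" for x
  proof -
    have "(\<lambda>g. (g, \<one>\<^bsub>T\<^esub>)) ` N \<subseteq> Q"
      unfolding Q_def
      using j1.exp_of_derived_img[OF N.subset, of n] exp_of_derived_perfect[OF N.subgroup_axioms perf, of n]
        P.mono_exp_of_derived[of "(\<lambda>g. (g, \<one>\<^bsub>T\<^esub>)) ` N" "carrier ?P" n] N.subset by auto
    then show ?thesis using that by blast
  qed
  have QD: "(\<one>, c) \<in> Q" if "c \<in> D" for c
  proof -
    have "(\<lambda>t. (\<one>, t)) ` D \<subseteq> Q"
      unfolding Q_def D_def
      using j2.exp_of_derived_img[OF order_refl, of n]
        P.mono_exp_of_derived[of "(\<lambda>t. (\<one>, t)) ` carrier T" "carrier ?P" n] by auto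
    then show ?thesis using that by blast
  qed
  have Q_sub: "g \<in> carrier G \<and> c \<in> D" if "(g, c) \<in> Q" for g c
  proof -
    have "snd ` carrier ?P = carrier T" using one_closed by (auto simp: snd_image_times)
    then have img: "snd ` Q = D"
      unfolding Q_def D_def using p2.exp_of_derived_img[OF order_refl, of n] by simp
    have "c \<in> D" using imageI[OF that, of snd] unfolding img by simp
    then show ?thesis using subsetD[OF subgroup.subset[OF sQ] that] by simp
  qed
  define \<psi> where "\<psi> = (\<lambda>g. \<pi> (g, \<one>\<^bsub>T\<^esub>))"
  have "(derived K ^^ n) (carrier K) = \<pi> ` Q"
    unfolding Q_def \<pi>_surj[symmetric] by (rule \<pi>.exp_of_derived_img[OF order_refl])
  moreover have "\<pi> ` Q = \<psi> ` carrier G"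
  proof (intro equalityI subsetI)
    fix y assume "y \<in> \<pi> ` Q"
    then obtain g c where gc: "(g, c) \<in> Q" "y = \<pi> (g, c)" by auto
    have g: "g \<in> carrier G" and c: "c \<in> D" using Q_sub[OF gc(1)] by auto
    have "g \<otimes> \<iota> c \<otimes> inv (\<iota> c) = g"
      using g \<iota>G[OF c] by (simp add: m_assoc)
    \<comment> \<open>A factor from \<open>Z\<close> moves the second coordinate \<open>c\<close>
      over to the first as \<open>\<iota> c\<close>.\<close>
    then have split: "(g \<otimes> \<iota> c, \<one>\<^bsub>T\<^esub>) \<otimes>\<^bsub>?P\<^esub> (inv (\<iota> c), c) = (g, c)"
      by (simp only: mult_DirProd T.l_one[OF D.mem_carrier[OF c]])
    have z: "(inv (\<iota> c), c) \<in> Z" unfolding Z_def using c by (rule imageI)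
    have g': "g \<otimes> \<iota> c \<in> carrier G" using g \<iota>G[OF c] by (rule m_closed)
    then have "(g \<otimes> \<iota> c, \<one>\<^bsub>T\<^esub>) \<in> carrier ?P" by simp
    then have "y = \<psi> (g \<otimes> \<iota> c)"
      using \<pi>_Z[OF _ z] split gc(2) unfolding \<psi>_def by metis
    then show "y \<in> \<psi> ` carrier G" using g' by (rule image_eqI)
  next
    fix y assume "y \<in> \<psi> ` carrier G"
    then obtain g where g: "g \<in> carrier G" "y = \<psi> g" by blast
    obtain x a where xa: "x \<in> N" "a \<in> A" "g = x \<otimes> a"
      using g(1) unfolding GNA set_mult_def by blast
    \<comment> \<open>Choosing \<open>c\<close> over \<open>inv a\<close> puts \<open>(a, c)\<close>
      into \<open>Z\<close>, so that \<open>(g, \<one>)\<close> and \<open>(x, inv c)\<close> have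
      the same image, and the latter pair is in \<open>Q\<close>.\<close>
    obtain c where c: "c \<in> D" "inv a = \<iota> c" using \<iota>_surj[OF A.m_inv_closed[OF xa(2)]] by blast
    have aG: "a \<in> carrier G" and xG: "x \<in> carrier G" using xa A.subset N.subset by auto
    have cT: "c \<in> carrier T" using D.mem_carrier[OF c(1)] .
    have "inv (\<iota> c) = a" using c(2)[symmetric] aG by simp
    then have az: "(a, c) \<in> Z" unfolding Z_def using c(1) by blast
    have q: "(x, inv\<^bsub>T\<^esub> c) \<in> Q"
      using subgroup.m_closed[OF sQ QN[OF xa(1)] QD[OF D.m_inv_closed[OF c(1)]]]
      by (simp only: mult_DirProd r_one[OF xG] T.l_one[OF T.inv_closed[OF cT]])
    have split: "(g, \<one>\<^bsub>T\<^esub>) = (x, inv\<^bsub>T\<^esub> c) \<otimes>\<^bsub>?P\<^esub> (a, c)"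
      by (simp only: xa(3) mult_DirProd T.l_inv[OF cT])
    have "(x, inv\<^bsub>T\<^esub> c) \<in> carrier ?P"
      unfolding carrier_DirProd using xG T.inv_closed[OF cT] by (rule SigmaI)
    then have "y = \<pi> (x, inv\<^bsub>T\<^esub> c)"
      using \<pi>_Z[OF _ az] split g(2) unfolding \<psi>_def by metis
    then show "y \<in> \<pi> ` Q" using q by (rule image_eqI)
  qed
  ultimately have K_n: "nth_derived_group n K = K\<lparr>carrier := \<psi> ` carrier G\<rparr>"
    by (simp add: nth_derived_group_def)
  have \<psi>_hom: "\<psi> \<in> hom G K"
    unfolding \<psi>_def using Group.hom_compose[OF j1.homh \<pi>.homh] by (simp only: comp_def)
  interpret \<psi>: group_hom G K \<psi>
    by (intro group_hom.intro group_hom_axioms.intro is_group K \<psi>_hom)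
  \<comment> \<open>An element of \<open>Z\<close> with trivial second coordinate comes from
    \<open>c = \<one>\<close>, so its first coordinate is trivial as well.\<close>
  have "inj_on \<psi> (carrier G)"
  proof (rule \<psi>.inj_on_one_iff[THEN iffD2], intro allI impI)
    fix g assume g: "g \<in> carrier G" and "\<psi> g = \<one>\<^bsub>K\<^esub>"
    then have "(g, \<one>\<^bsub>T\<^esub>) \<in> Z" using \<pi>_one_iff[of "(g, \<one>\<^bsub>T\<^esub>)"] by (simp add: \<psi>_def)
    then show "g = \<one>" using \<iota>_one by (auto simp: Z_def)
  qed
  then have "\<psi> \<in> iso G (nth_derived_group n K)"
    using \<psi>_hom unfolding K_n by (auto simp: iso_def hom_def bij_betw_def)
  then have "nth_derived_group n K \<cong> G" using iso_sym is_isoI by blast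
  moreover have "finite (carrier K)"
    unfolding \<pi>_surj[symmetric] using fin T(2) by simp
  moreover have "nilpotent_group K" if "comm_group G"
  proof -
    \<comment> \<open>As \<open>2 ^ n\<close> is positive, the series of the abelian group
      \<open>G\<close> is trivial at this index too; triviality then passes to the quotient
      \<open>K\<close>.\<close>
    have "lower_central_series ?P (2 ^ n) \<subseteq> {\<one>\<^bsub>?P\<^esub>}"
    proof -
      have "lower_central_series G (2 ^ n) \<subseteq> {\<one>}"
        by (rule comm_group.lower_central_series_trivial[OF that]) (rule zero_less_power, rule zero_less_numeral)
      then have "lower_central_series G (2 ^ n) \<times> lower_central_series T (2 ^ n) \<subseteq> {\<one>} \<times> {\<one>\<^bsub>T\<^esub>}"
        using T(3) by (rule Sigma_mono)
      also have "\<dots> = {\<one>\<^bsub>?P\<^esub>}" by (simp only: one_DirProd insert_Times_insert Times_empty) blast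
      finally show ?thesis
        by (rule order_trans[OF lower_central_series_DirProd[OF is_group T.is_group]])
    qed
    then have "\<pi> ` lower_central_series ?P (2 ^ n) \<subseteq> \<pi> ` {\<one>\<^bsub>?P\<^esub>}" by (rule image_mono)
    also have "\<dots> = {\<one>\<^bsub>K\<^esub>}" by (simp only: image_insert image_empty \<pi>.hom_one)
    also have "\<pi> ` lower_central_series ?P (2 ^ n) = lower_central_series K (2 ^ n)"
      by (rule \<pi>.lower_central_series_img[OF \<pi>_surj, symmetric])
    finally have "lower_central_series K (2 ^ n) \<subseteq> {\<one>\<^bsub>K\<^esub>}" .
    then have "lower_central_series K (2 ^ n) = {\<one>\<^bsub>K\<^esub>}"
      using group.one_in_lower_central_series[OF K, of "2 ^ n"]
      by (intro equalityI) simp_all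
    then show ?thesis
      unfolding nilpotent_group_def using K by blast
  qed
  ultimately show ?thesis using K by blast
qed

section \<open>Transport to an arbitrary infinite type\<close>

lemma nth_derived_group_iso:
  assumes "group K" "group H" and \<phi>: "\<phi> \<in> iso K H"
  shows "nth_derived_group n K \<cong> nth_derived_group n H"
proof -
  interpret \<phi>: group_hom K H \<phi>
    using assms by (simp add: group_hom_def group_hom_axioms_def iso_def)
  have bij: "bij_betw \<phi> (carrier K) (carrier H)" using \<phi> by (simp add: iso_def)
  let ?D = "(derived K ^^ n) (carrier K)"
  have D: "?D \<subseteq> carrier K" by (rule \<phi>.G.exp_of_derived_in_carrier[OF order_refl])
  have img: "(derived H ^^ n) (carrier H) = \<phi> ` ?D"
    using \<phi>.exp_of_derived_img[OF order_refl, of n] bij by (simp add: bij_betw_def)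
  have "inj_on \<phi> ?D" using bij D by (auto simp: bij_betw_def intro: inj_on_subset)
  then have "\<phi> \<in> iso (nth_derived_group n K) (nth_derived_group n H)"
    unfolding nth_derived_group_def img using D
    by (auto simp: iso_def hom_def bij_betw_def subset_iff)
  then show ?thesis by (rule is_isoI)
qed

lemma nilpotent_group_iso:
  assumes "nilpotent_group K" "group H" and \<phi>: "\<phi> \<in> iso K H"
  shows "nilpotent_group H"
proof -
  have K: "group K" using assms(1) by (simp add: nilpotent_group_def)
  interpret \<phi>: group_hom K H \<phi>
    using assms K by (simp add: group_hom_def group_hom_axioms_def iso_def)
  obtain c where "lower_central_series K c = {\<one>\<^bsub>K\<^esub>}" using assms(1) by (auto simp: nilpotent_group_def)
  moreover have "\<phi> ` carrier K = carrier H" using \<phi> by (simp add: iso_def bij_betw_def)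
  ultimately have "lower_central_series H c = {\<one>\<^bsub>H\<^esub>}"
    using \<phi>.lower_central_series_img[of c] by simp
  with assms(2) show ?thesis unfolding nilpotent_group_def by blast
qed

text \<open>An infinite type contains a set of the size of \<open>G\<close>, onto which the group
  structure is carried by a bijection.\<close>

lemma (in group) ex_iso_infinite_type:
  assumes "finite (carrier G)" "infinite (UNIV :: 'h set)"
  shows "\<exists>(H :: 'h monoid) \<phi>. group H \<and> \<phi> \<in> iso G H"
proof -
  obtain S :: "'h set" where S: "finite S" "card S = card (carrier G)"
    using infinite_arbitrarily_large[OF assms(2)] by blast
  then obtain f where "bij_betw f (carrier G) S"
    using finite_same_card_bij[OF assms(1) S(1)] by auto
  then have "inj_on f (carrier G)" by (simp add: bij_betw_def)
  then show ?thesis using inj_imp_image_group_is_group inj_imp_image_group_iso by blast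
qed

text \<open>The constructed \<open>K\<close> lives on a type of cosets. Being finite, it has an
  isomorphic copy over any infinite type, and the derived group and nilpotency follow the
  isomorphism.\<close>

lemma (in group) central_product_integral_infinite_type:
  assumes "finite (carrier G)" "central_product G N A"
    "perfect_group (G\<lparr>carrier := N\<rparr>)" "comm_group (G\<lparr>carrier := A\<rparr>)"
    and inf: "infinite (UNIV :: 'h set)"
  shows "\<exists>H :: 'h monoid. group H \<and> finite (carrier H) \<and> nth_derived_group n H \<cong> G \<and>
    (comm_group G \<longrightarrow> nilpotent_group H)"
proof -
  obtain K :: "('a \<times> ((nat \<times> 'a \<Rightarrow> 'a) \<Rightarrow> nat \<times> 'a \<Rightarrow> 'a)) set monoid"
    where K: "group K" "finite (carrier K)" "nth_derived_group n K \<cong> G"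
      "comm_group G \<longrightarrow> nilpotent_group K"
    using central_product_integral[OF assms(1-4), of n] by blast
  obtain H :: "'h monoid" and \<phi> where H: "group H" "\<phi> \<in> iso K H"
    using group.ex_iso_infinite_type[OF K(1,2) inf] by blast
  have "nth_derived_group n H \<cong> nth_derived_group n K"
    using nth_derived_group_iso[OF K(1) H(1,2)] group.iso_sym[OF group.nth_derived_group_group[OF K(1)]]
    by blast
  then have "nth_derived_group n H \<cong> G" using K(3) iso_trans by blast
  moreover have "finite (carrier H)"
    using H(2) K(2) by (auto simp: iso_def bij_betw_finite)
  moreover have "comm_group G \<longrightarrow> nilpotent_group H"
    using K(4) nilpotent_group_iso H by blast
  ultimately show ?thesis using H(1) by blast
qed

text \<open>With a trivial perfect factor, the abelian case becomes an instance of the construction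
  for central products.\<close>

lemma (in comm_group) trivial_central_product:
  "central_product G {\<one>} (carrier G)" "perfect_group (G\<lparr>carrier := {\<one>}\<rparr>)"
proof -
  have "(\<Union>x \<in> {\<one>}. \<Union>y \<in> carrier G. {x \<otimes> y \<otimes> inv x \<otimes> inv y}) = {\<one>}"
    using one_closed by auto
  then show "central_product G {\<one>} (carrier G)"
    unfolding central_product_def commutator_subgroup_def
    using one_is_normal normal_self generate_one by (auto simp: set_mult_def)
  show "perfect_group (G\<lparr>carrier := {\<one>}\<rparr>)"
    unfolding perfect_group_def
    using subgroup_imp_group[OF triv_subgroup] derived_consistent[OF order_refl triv_subgroup]
      derived_eq_singleton[of "{\<one>}"] by simp
qed

theorem theorem8p2:
  fixes G :: "('a, 'b) monoid_scheme"
  assumes "group G" and "finite (carrier G)"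
    and "infinite (UNIV :: 'h set)"
  shows "(comm_group G \<longrightarrow>
           (\<forall>n. \<exists>H :: 'h monoid.
              finite (carrier H) \<and> nilpotent_group H \<and> nth_derived_group n H \<cong> G)) \<and>
         ((\<forall>n. integrable_times TYPE('h) n G) \<longleftrightarrow>
           (\<exists>N A. central_product G N A \<and>
              perfect_group (G\<lparr>carrier := N\<rparr>) \<and> comm_group (G\<lparr>carrier := A\<rparr>)))"
proof (intro conjI impI iffI allI)
  interpret group G by fact
  show "\<exists>H :: 'h monoid. finite (carrier H) \<and> nilpotent_group H \<and> nth_derived_group n H \<cong> G"
    if "comm_group G" for n
  proof -
    interpret comm_group G by fact
    show ?thesis
      using central_product_integral_infinite_type
        [OF assms(2) trivial_central_product _ assms(3), of n] that by auto
  qed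
  show "\<exists>N A. central_product G N A \<and> perfect_group (G\<lparr>carrier := N\<rparr>) \<and>
      comm_group (G\<lparr>carrier := A\<rparr>)"
    if "\<forall>n. integrable_times TYPE('h) n G"
    using integrable_imp_central_product[OF assms(2)] that by blast
  show "integrable_times TYPE('h) n G"
    if "\<exists>N A. central_product G N A \<and> perfect_group (G\<lparr>carrier := N\<rparr>) \<and>
      comm_group (G\<lparr>carrier := A\<rparr>)" for n
    using that central_product_integral_infinite_type[OF assms(2) _ _ _ assms(3), of _ _ n]
    unfolding integrable_times_def by blast
qed

end
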